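(* Let $b$ and $d$ be integers with $2\le b\le d$, let $(\epsilon_1,\epsilon_2,\epsilon_3,\epsilon_4,\epsilon_5)\in\{0,1\}^5$, and let $\alpha_i\in\mathbb{Z}$ for $n_{b-1}+1\le i\le n_d$. Suppose that the following conditions are satisfied: - if $\epsilon_1=1$, then $\sum_{n_{b-1}+1\le i\le n_d}\alpha_i\tilde{x}_i(r)=0$ for each $r\in R_{10000}(b,d)$; - if $\epsilon_2=1$, then $\sum_{n_{b-1}+1\le i\le n_d}\alpha_i\tilde{x}_i(r)=0$ for each $r\in R_{01000}(b,d)$; - if $\epsilon_3=1$, then $\sum_{n_{b-1}+1\le i\le n_d}\alpha_i\tilde{x}_i(r)=0$ for each $r\in R_{00100}(b,d)$; - if $\epsilon_4=1$, then $\sum_{n_{b-1}+1\le i\le n_d}\alpha_i\tilde{x}_i(r)=0$ for each $r\in R_{00010}(b,d)$; - if $\epsilon_5=1$, then $\sum_{n_{b-1}+1\le i\le n_d}\alpha_i\tilde{x}_i(r)=0$ for each $r\in R_{00001}(b,d)$. Then the integer-valued function $P\mapsto\sum_{n_{b-1}+1\le i\le n_d}\alpha_i x_i(P)$ on the set of ambient isotopy classes of spherical/plane curves is invariant under the Reidemeister moves corresponding to those $j$ with $\epsilon_j=1$, where $j=1,2,3,4,5$ corresponds to RI, strong RII, weak RII, strong RIII, weak RIII, respectively.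
   Context: **Curves and moves.** A spherical (plane) curve is the image of a generic immersion of a circle into $S^2$ ($\mathbb{R}^2$). Curves are considered up to ambient isotopy. The Reidemeister moves RI, RII, RIII are the usual local moves on knot diagrams with over/under information ignored: RI adds or removes a monogon (kink), RII adds or removes a bigon, RIII moves a strand across a double point (replacing a triangle by the opposite triangle). An RII (RIII) is called strong if, for an orientation of the curve, the induced orientations on the edges of the bigon (triangle) involved are coherent (form a directed cycle); otherwise it is called weak. In terms of Gauss words (defined below): if $P$ and $P'$ are related by a single RI (strong RII, weak RII, strong RIII, weak RIII, resp.) then, after exchanging $P$ and $P'$ if necessary, $CD_P=[G]$ and $CD_{P'}=[G']$ with $G=Sii$ ($SijTji$, $SijTij$, $SijTkiUjk$, $SijTikUjk$, resp.) and $G'=S$ ($ST$, $ST$, $SjiTikUkj$, $SjiTkiUkj$, resp.). **Gauss words and chord diagrams.** A Gauss word of length $2n$ is a word of length $2n$ in which each occurring letter appears exactly twice (the empty word is allowed). Two Gauss words of the same length are isomorphic if they agree up to a bijective renaming of letters, cyclic rotation, and reversal; $[v]$ denotes the isomorphism class of $v$. Isomorphism classes of Gauss words are identified with chord diagrams (configurations of $n$ pairs of points on a circle, up to ambient isotopy and reflection of the circle; each pair is joined by a chord). A sub-Gauss word of $v$ is a word obtained from $v$ by deleting all occurrences of some (possibly none, possibly all) of its letters; $\mathrm{Sub}(v)$ is the set of sub-Gauss words of $v$ (one for each subset of letters). For a spherical/plane curve $P=g(S^1)$, the chord diagram $CD_P$ is given by the pairs of points $g^{-1}(\text{double point})$ on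 $S^1$, one pair for each double point. **Notation.** $G_{<\infty}$ is the set of all chord diagrams, $G_{\le d}$ the set of those with at most $d$ chords, $n_d=|G_{\le d}|$, and $G_{b,d}=G_{\le d}\setminus G_{\le b-1}$. Fix an enumeration $\{x_i\}_{i\in\mathbb{N}}$ of $G_{<\infty}$ such that the number of chords is non-decreasing in $i$; so $G_{\le d}=\{x_1,\dots,x_{n_d}\}$ and $G_{b,d}=\{x_i\}_{n_{b-1}+1\le i\le n_d}$. For a chord diagram $x$ and a curve $P$ with $CD_P=[G]$, $x(P)=|\{H\in\mathrm{Sub}(G): [H]=x\}|$, i.e. the number of sub-chord diagrams of $CD_P$ isomorphic to $x$. For a chord diagram $x$, $\tilde{x}$ is the $\mathbb{Z}$-linear functional on the free $\mathbb{Z}$-module generated by chord diagrams with $\tilde{x}(x)=1$ and $\tilde{x}(y)=0$ for every chord diagram $y\ne x$. $\mathbb{Z}[G_{\le l}]$ is the free $\mathbb{Z}$-module on $G_{\le l}$. **Relators.** (Elements of $\bigcup_{l\ge1}\mathbb{Z}[G_{\le l}]$; $S,T,U$ are possibly empty words such that $S$, $ST$, $STU$, respectively, is a Gauss word, and $i,j,k$ are distinct letters not occurring in it.) $R_1$, Type (I): all $[Sii]$. $R_2$, Type (SII): all $[SijTji]+[SiTi]+[SjTj]$. $R_3$, Type (WII): all $[SijTij]+[SiTi]+[SjTj]$. $R_4$, Type (SIII): all $([SijTkiUjk]+[SijTiUj]+[SiTkiUk]+[SjTkUjk])-([SjiTikUkj]+[SjiTiUj]+[SiTikUk]+[SjTkUkj])$.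 $R_5$, Type (WIII): all $([SijTikUjk]+[SijTiUj]+[SiTikUk]+[SjTkUjk])-([SjiTkiUkj]+[SjiTiUj]+[SiTkiUk]+[SjTkUkj])$. For $(\epsilon_1,\dots,\epsilon_5)\in\{0,1\}^5$ let $R_{\epsilon_1\epsilon_2\epsilon_3\epsilon_4\epsilon_5}=\bigcup_{\epsilon_i=1}R_i$. Let $O_{b,d}$ be the linear projection onto $\mathbb{Z}[G_{b,d}]$ (it fixes the generators in $G_{b,d}$ and sends all other chord diagrams to $0$), and let $R_{\epsilon_1\epsilon_2\epsilon_3\epsilon_4\epsilon_5}(b,d)=O_{b,d}(R_{\epsilon_1\epsilon_2\epsilon_3\epsilon_4\epsilon_5})$. *)

theory Defs
  imports "HOL-Analysis.Analysis" "HOL-Library.Poly_Mapping"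
begin

section \<open>Gauss words and chord diagrams\<close>

definition gauss_word :: "'a list \<Rightarrow> bool" where
  "gauss_word v \<longleftrightarrow> (\<forall>a \<in> set v. count_list v a = 2)"

definition gauss_iso :: "'a list \<Rightarrow> 'b list \<Rightarrow> bool" where
  "gauss_iso v w \<longleftrightarrow>
     (\<exists>f n. inj_on f (set v) \<and> (w = rotate n (map f v) \<or> w = rotate n (rev (map f v))))"

text \<open>Words may have letters of any type; the isomorphism class is always recorded by its members
  over the alphabet \<open>nat\<close>, which determine it.\<close>

definition gauss_class :: "'a list \<Rightarrow> nat list set" where
  "gauss_class v = {w. gauss_iso v w}"

typedef chord_diagram = "{gauss_class v | v :: nat list. gauss_word v}"
  by (rule exI[of _ "gauss_class []"]) (auto simp: gauss_word_def)

text \<open>The class \<open>[v]\<close>; only meaningful if \<open>v\<close> is a Gauss word.\<close>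

definition diagram :: "'a list \<Rightarrow> chord_diagram" where
  "diagram v = Abs_chord_diagram (gauss_class v)"

definition representative :: "chord_diagram \<Rightarrow> nat list" where
  "representative x = (SOME v. gauss_word v \<and> diagram v = x)"

definition num_chords :: "chord_diagram \<Rightarrow> nat" where
  "num_chords x = card (set (representative x))"

text \<open>Distinct sets of letters have distinct restrictions of \<open>v\<close>, so this set contains exactly one
  word for each subset of the letters of \<open>v\<close>.\<close>

definition Sub :: "'a list \<Rightarrow> 'a list set" where
  "Sub v = {filter (\<lambda>a. a \<in> A) v | A. A \<subseteq> set v}"

definition sub_count :: "chord_diagram \<Rightarrow> chord_diagram \<Rightarrow> nat" where
  "sub_count x y = card {H \<in> Sub (representative y). diagram H = x}"

definition G_upto :: "nat \<Rightarrow> chord_diagram set" where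
  "G_upto d = {x. num_chords x \<le> d}"

definition G_between :: "nat \<Rightarrow> nat \<Rightarrow> chord_diagram set" where
  "G_between b d = G_upto d - G_upto (b - 1)"

definition n_upto :: "nat \<Rightarrow> nat" where
  "n_upto d = card (G_upto d)"

text \<open>Enumerations are indexed from 1; the value at 0 is irrelevant.\<close>

definition chord_enumeration :: "(nat \<Rightarrow> chord_diagram) \<Rightarrow> bool" where
  "chord_enumeration x \<longleftrightarrow>
     bij_betw x {1..} UNIV \<and> (\<forall>i j. 1 \<le> i \<and> i \<le> j \<longrightarrow> num_chords (x i) \<le> num_chords (x j))"


section \<open>Relators\<close>

datatype move = RI | strong_RII | weak_RII | strong_RIII | weak_RIII

abbreviation gen :: "nat list \<Rightarrow> chord_diagram \<Rightarrow>\<^sub>0 int" where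
  "gen v \<equiv> frag_of (diagram v)"

fun relators1 :: "move \<Rightarrow> (chord_diagram \<Rightarrow>\<^sub>0 int) set" where
  "relators1 RI =
     {gen (S @ [i, i]) | S i. gauss_word S \<and> i \<notin> set S}"
| "relators1 strong_RII =
     {gen (S @ [i, j] @ T @ [j, i]) + gen (S @ [i] @ T @ [i]) + gen (S @ [j] @ T @ [j]) | S T i j.
        gauss_word (S @ T) \<and> distinct [i, j] \<and> {i, j} \<inter> set (S @ T) = {}}"
| "relators1 weak_RII =
     {gen (S @ [i, j] @ T @ [i, j]) + gen (S @ [i] @ T @ [i]) + gen (S @ [j] @ T @ [j]) | S T i j.
        gauss_word (S @ T) \<and> distinct [i, j] \<and> {i, j} \<inter> set (S @ T) = {}}"
| "relators1 strong_RIII =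
     {(gen (S @ [i, j] @ T @ [k, i] @ U @ [j, k]) + gen (S @ [i, j] @ T @ [i] @ U @ [j])
        + gen (S @ [i] @ T @ [k, i] @ U @ [k]) + gen (S @ [j] @ T @ [k] @ U @ [j, k]))
      - (gen (S @ [j, i] @ T @ [i, k] @ U @ [k, j]) + gen (S @ [j, i] @ T @ [i] @ U @ [j])
        + gen (S @ [i] @ T @ [i, k] @ U @ [k]) + gen (S @ [j] @ T @ [k] @ U @ [k, j])) | S T U i j k.
        gauss_word (S @ T @ U) \<and> distinct [i, j, k] \<and> {i, j, k} \<inter> set (S @ T @ U) = {}}"
| "relators1 weak_RIII =
     {(gen (S @ [i, j] @ T @ [i, k] @ U @ [j, k]) + gen (S @ [i, j] @ T @ [i] @ U @ [j])
        + gen (S @ [i] @ T @ [i, k] @ U @ [k]) + gen (S @ [j] @ T @ [k] @ U @ [j, k]))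
      - (gen (S @ [j, i] @ T @ [k, i] @ U @ [k, j]) + gen (S @ [j, i] @ T @ [i] @ U @ [j])
        + gen (S @ [i] @ T @ [k, i] @ U @ [k]) + gen (S @ [j] @ T @ [k] @ U @ [k, j])) | S T U i j k.
        gauss_word (S @ T @ U) \<and> distinct [i, j, k] \<and> {i, j, k} \<inter> set (S @ T @ U) = {}}"

definition relators :: "(move \<Rightarrow> nat) \<Rightarrow> (chord_diagram \<Rightarrow>\<^sub>0 int) set" where
  "relators \<epsilon> = (\<Union>m \<in> {m. \<epsilon> m = 1}. relators1 m)"

definition proj :: "nat \<Rightarrow> nat \<Rightarrow> (chord_diagram \<Rightarrow>\<^sub>0 int) \<Rightarrow> (chord_diagram \<Rightarrow>\<^sub>0 int)" where
  "proj b d = frag_extend (\<lambda>x. if x \<in> G_between b d then frag_of x else 0)"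

definition relators_between :: "(move \<Rightarrow> nat) \<Rightarrow> nat \<Rightarrow> nat \<Rightarrow> (chord_diagram \<Rightarrow>\<^sub>0 int) set" where
  "relators_between \<epsilon> b d = proj b d ` relators \<epsilon>"

definition dual :: "chord_diagram \<Rightarrow> (chord_diagram \<Rightarrow>\<^sub>0 int) \<Rightarrow> int" where
  "dual x r = Poly_Mapping.lookup r x"


section \<open>Curves\<close>

text \<open>The surface \<open>M\<close> is a subset of a Euclidean space (the unit sphere or the plane). The source
  circle is the quotient of the reals by the integers, i.e. immersions are 1-periodic, and
  \<open>{0..<1}\<close> is a fundamental domain. An immersion is a \<open>C\<^sup>1\<close> map with
  nonvanishing derivative.\<close>

definition double_times :: "(real \<Rightarrow> 'a) \<Rightarrow> real set" where
  "double_times g = {t \<in> {0..<1}. \<exists>s \<in> {0..<1}. s \<noteq> t \<and> g s = g t}"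

definition generic_immersion :: "'a::euclidean_space set \<Rightarrow> (real \<Rightarrow> 'a) \<Rightarrow> bool" where
  "generic_immersion M g \<longleftrightarrow>
     range g \<subseteq> M \<and> (\<forall>t. g (t + 1) = g t) \<and>
     g C1_differentiable_on UNIV \<and> (\<forall>t. vector_derivative g (at t) \<noteq> 0) \<and>
     finite (double_times g) \<and>
     (\<forall>r \<in> {0..<1}. \<forall>s \<in> {0..<1}. \<forall>t \<in> {0..<1}.
        g r = g s \<and> g s = g t \<longrightarrow> r = s \<or> s = t \<or> r = t) \<and>
     (\<forall>s \<in> {0..<1}. \<forall>t \<in> {0..<1}. s \<noteq> t \<and> g s = g t \<longrightarrow>
        vector_derivative g (at s) \<notin> span {vector_derivative g (at t)})"

definition curve :: "'a::euclidean_space set \<Rightarrow> 'a set \<Rightarrow> bool" where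
  "curve M P \<longleftrightarrow> (\<exists>g. generic_immersion M g \<and> range g = P)"

text \<open>The letters of the Gauss word of an immersion are its double points, read along the circle.\<close>

definition word_of :: "(real \<Rightarrow> 'a) \<Rightarrow> 'a list" where
  "word_of g = map g (sorted_list_of_set (double_times g))"

definition CD :: "'a::euclidean_space set \<Rightarrow> 'a set \<Rightarrow> chord_diagram" where
  "CD M P = diagram (word_of (SOME g. generic_immersion M g \<and> range g = P))"


section \<open>Ambient isotopy\<close>

text \<open>Continuous differentiability on \<open>M\<close>, in the sense of submanifolds: on an open neighbourhood
  of \<open>M\<close>.\<close>

definition C1_near :: "'a::euclidean_space set \<Rightarrow> ('a \<Rightarrow> 'a) \<Rightarrow> bool" where
  "C1_near M h \<longleftrightarrow>
     (\<exists>U h'. open U \<and> M \<subseteq> U \<and> continuous_on U h' \<and>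
        (\<forall>x \<in> U. (h has_derivative blinfun_apply (h' x)) (at x)))"

definition diffeomorphism :: "'a::euclidean_space set \<Rightarrow> ('a \<Rightarrow> 'a) \<Rightarrow> bool" where
  "diffeomorphism M h \<longleftrightarrow> C1_near M h \<and> (\<exists>k. C1_near M k \<and> homeomorphism M M h k)"

definition ambient_isotopic :: "'a::euclidean_space set \<Rightarrow> 'a set \<Rightarrow> 'a set \<Rightarrow> bool" where
  "ambient_isotopic M P Q \<longleftrightarrow>
     (\<exists>H :: real \<Rightarrow> 'a \<Rightarrow> 'a.
        continuous_on ({0..1} \<times> M) (\<lambda>(s, x). H s x) \<and>
        (\<forall>s \<in> {0..1}. diffeomorphism M (H s)) \<and>
        (\<forall>x \<in> M. H 0 x = x) \<and> H 1 ` P = Q)"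


section \<open>Reidemeister moves\<close>

text \<open>Standard pictures of the two sides of each move, as proper arcs in a square parametrized by
  the interval from -1 to 1. Corresponding arcs of the two sides have the same end points.

  RI: the first arc passes through \<open>(0, -1/4)\<close> at the parameters \<open>-1/2\<close> and \<open>1/2\<close>, forming a
  monogon.

  RII: on the first side, the arcs meet in \<open>(-1/2, 0)\<close> and \<open>(1/2, 0)\<close>, the corners of a bigon. Its
  upper edge is traversed from left to right and its lower edge from right to left, so the
  orientations of the model arcs form a directed cycle.

  RIII: two straight arcs meet in the origin, and the remaining arc, running from left to right, is
  moved across the origin, from above to below. The triangles have corners \<open>(0, 0)\<close>,
  \<open>(-1/2, 1/4)\<close>, \<open>(1/2, 1/4)\<close> and \<open>(0, 0)\<close>, \<open>(-1/2, -1/4)\<close>, \<open>(1/2, -1/4)\<close>. The orientations of the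
  model arcs form a directed cycle on either of them.\<close>

abbreviation square :: "(real \<times> real) set" where
  "square \<equiv> cbox (-1, -1) (1, 1)"

definition arcs_RII :: "(real \<Rightarrow> real \<times> real) list" where
  "arcs_RII = [\<lambda>t. (t, 0), \<lambda>t. (- t, t\<^sup>2 - 1/4)]"

definition arcs_RII' :: "(real \<Rightarrow> real \<times> real) list" where
  "arcs_RII' = [\<lambda>t. (t, 0), \<lambda>t. (- t, 3/4)]"

definition arcs_RIII :: "(real \<Rightarrow> real \<times> real) list" where
  "arcs_RIII = [\<lambda>t. (t, (1 - t\<^sup>2) / 3), \<lambda>t. (- t, - t / 2), \<lambda>t. (- t, t / 2)]"

definition arcs_RIII' :: "(real \<Rightarrow> real \<times> real) list" where
  "arcs_RIII' = [\<lambda>t. (t, - (1 - t\<^sup>2) / 3), \<lambda>t. (- t, - t / 2), \<lambda>t. (- t, t / 2)]"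

fun arcs :: "move \<Rightarrow> (real \<Rightarrow> real \<times> real) list" where
  "arcs RI = [\<lambda>t. ((4 * t ^ 3 - t) / 3, t\<^sup>2 - 1/2)]"
| "arcs strong_RII = arcs_RII"
| "arcs weak_RII = arcs_RII"
| "arcs strong_RIII = arcs_RIII"
| "arcs weak_RIII = arcs_RIII"

fun arcs' :: "move \<Rightarrow> (real \<Rightarrow> real \<times> real) list" where
  "arcs' RI = [\<lambda>t. (t, 1/2)]"
| "arcs' strong_RII = arcs_RII'"
| "arcs' weak_RII = arcs_RII'"
| "arcs' strong_RIII = arcs_RIII'"
| "arcs' weak_RIII = arcs_RIII'"

text \<open>The sign of an arc is 1 if the curve traverses it in the direction of the model, and -1
  otherwise. Since the model arcs are oriented coherently, the bigon or triangle is coherently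
  oriented by the curve if and only if all signs agree.\<close>

fun admissible_signs :: "move \<Rightarrow> (nat \<Rightarrow> real) \<Rightarrow> bool" where
  "admissible_signs RI e \<longleftrightarrow> True"
| "admissible_signs strong_RII e \<longleftrightarrow> e 0 = e 1"
| "admissible_signs weak_RII e \<longleftrightarrow> \<not> (e 0 = e 1)"
| "admissible_signs strong_RIII e \<longleftrightarrow> e 0 = e 1 \<and> e 1 = e 2"
| "admissible_signs weak_RIII e \<longleftrightarrow> \<not> (e 0 = e 1 \<and> e 1 = e 2)"

definition traverses :: "(real \<Rightarrow> 'a) \<Rightarrow> real \<Rightarrow> real \<Rightarrow> (real \<Rightarrow> 'a) \<Rightarrow> real \<Rightarrow> bool" where
  "traverses g a b A e \<longleftrightarrow>
     (\<exists>\<rho> :: real \<Rightarrow> real. continuous_on {a..b} \<rho> \<and> strict_mono_on {a..b} \<rho> \<and> \<rho> a = -1 \<and> \<rho> b = 1 \<and>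
        (\<forall>t \<in> {a..b}. g t = A (e * \<rho> t)))"

text \<open>\<open>P\<close> and \<open>P'\<close> coincide outside the disc \<open>D = h ` square = h' ` square\<close>, and inside \<open>D\<close> they are
  the two sides of the move. As \<open>square\<close> is compact, \<open>h\<close> and \<open>h'\<close> are homeomorphisms onto \<open>D\<close>; they
  agree on the boundary, hence are isotopic relative to it. The intervals \<open>{a k..b k}\<close> are the
  times spent in \<open>D\<close>, in no particular order; the base point of the circle is outside \<open>D\<close>.\<close>

definition local_move :: "'a::euclidean_space set \<Rightarrow> move \<Rightarrow> 'a set \<Rightarrow> 'a set \<Rightarrow> bool" where
  "local_move M m P P' \<longleftrightarrow>
     (\<exists>g g' h h' a b e. let n = length (arcs m) in
        generic_immersion M g \<and> range g = P \<and> generic_immersion M g' \<and> range g' = P' \<and>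
        continuous_on square h \<and> inj_on h square \<and> continuous_on square h' \<and> inj_on h' square \<and>
        h ` square \<subseteq> M \<and> h' ` square = h ` square \<and> (\<forall>z \<in> frontier square. h' z = h z) \<and>
        (\<forall>k<n. 0 < a k \<and> a k < b k \<and> b k < 1 \<and> e k \<in> {1, -1}) \<and>
        disjoint_family_on (\<lambda>k. {a k..b k}) {..<n} \<and> admissible_signs m e \<and>
        (\<forall>k<n. traverses g (a k) (b k) (h \<circ> arcs m ! k) (e k) \<and>
               traverses g' (a k) (b k) (h' \<circ> arcs' m ! k) (e k)) \<and>
        (\<forall>t \<in> {0..1} - (\<Union>k<n. {a k..b k}). g' t = g t \<and> g t \<notin> h ` square))"

definition move_related :: "'a::euclidean_space set \<Rightarrow> move \<Rightarrow> 'a set \<Rightarrow> 'a set \<Rightarrow> bool" where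
  "move_related M m P P' \<longleftrightarrow> local_move M m P P' \<or> local_move M m P' P"


section \<open>Invariance\<close>

definition diagram_function ::
    "(nat \<Rightarrow> chord_diagram) \<Rightarrow> (nat \<Rightarrow> int) \<Rightarrow> nat \<Rightarrow> nat \<Rightarrow> 'a::euclidean_space set \<Rightarrow> 'a set \<Rightarrow> int" where
  "diagram_function x \<alpha> b d M P =
     (\<Sum>i = n_upto (b - 1) + 1..n_upto d. \<alpha> i * int (sub_count (x i) (CD M P)))"

definition isotopy_invariant :: "'a::euclidean_space set \<Rightarrow> ('a set \<Rightarrow> int) \<Rightarrow> bool" where
  "isotopy_invariant M F \<longleftrightarrow>
     (\<forall>P Q. curve M P \<and> curve M Q \<and> ambient_isotopic M P Q \<longrightarrow> F P = F Q)"

definition move_invariant :: "'a::euclidean_space set \<Rightarrow> move \<Rightarrow> ('a set \<Rightarrow> int) \<Rightarrow> bool" where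
  "move_invariant M m F \<longleftrightarrow>
     (\<forall>P Q. curve M P \<and> curve M Q \<and> move_related M m P Q \<longrightarrow> F P = F Q)"

abbreviation unit_sphere :: "(real ^ 3) set" where
  "unit_sphere \<equiv> sphere 0 1"

abbreviation plane :: "(real ^ 2) set" where
  "plane \<equiv> UNIV"

end

theory Submission
  imports Defs
begin

text \<open>The number of subdiagrams of type \<open>x\<close> is a sum over the subsets of the letters of a Gauss word
  of the curve. Splitting such a subset into the letters that take part in a move and the remaining
  ones turns the difference of the two sides of the move into a sum of values on relators.

  On the geometric side, the Gauss word depends only on the image of the immersion: by transversality,
  a time is determined by its position and its tangent line, so two immersions with the same image
  differ by a homeomorphism of the circle, which preserves or reverses the cyclic order. For a move,
  the word is read off from the crossings of the model arcs; all orders and orientations of the arcs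
  reduce to the standard ones by rotating the word and exchanging the two sides.\<close>

section \<open>Gauss words\<close>

text \<open>The relators are what remains of a move after expanding over letter subsets. Subsets
  avoiding the letters of the move contribute equally to both sides; for RIII so do those with
  exactly one of the three letters. The other subsets combine, one relator for each set of outer
  letters. These relators can have any number of chords, whereas the hypotheses speak of their
  projections to \<open>G_between b d\<close>. Functionals dual to diagrams in that range do not see
  the projection, so the weighted sum of duals vanishes on the full relators, and the algebra can
  proceed without b and d.

  Two mismatches shape the rest. The letters of a curve are points of M, and RIII replaces its
  crossings by other points, while relators are words over \<open>nat\<close>; patterns of numbers
  mediate between them. And \<open>CD\<close> reads its word from an arbitrarily chosen
  parametrization, while a move provides particular ones; position alone does not determine the
  change of parameter at a crossing.\<close>

lemma gauss_isoI:
  assumes "inj_on f (set v)" and "w = rotate n (map f v) \<or> w = rotate n (rev (map f v))"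
  shows "gauss_iso v w"
  using assms unfolding gauss_iso_def by blast

lemma gauss_iso_refl: "gauss_iso v v"
  by (rule gauss_isoI[of id _ _ 0]) auto

lemma rev_rotate_ex: "\<exists>m. rev (rotate n xs) = rotate m (rev xs)"
proof (induction n)
  case 0
  have "rev (rotate 0 xs) = rotate 0 (rev xs)" by simp
  then show ?case ..
next
  case (Suc n)
  then obtain m where m: "rev (rotate n xs) = rotate m (rev xs)" by blast
  have "\<exists>k. rev (rotate1 ys) = rotate k (rev ys)" for ys :: "'a list"
  proof (cases ys)
    case (Cons y zs)
    have "rotate (length zs) (rev zs @ [y]) = [y] @ rev zs"
      using rotate_append[of "rev zs" "[y]"] by simp
    then show ?thesis using Cons by (intro exI[of _ "length zs"]) simp
  qed simp
  then obtain k where "rev (rotate1 (rotate n xs)) = rotate k (rev (rotate n xs))" by blast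
  then show ?case using m by (auto simp: rotate_rotate)
qed

lemma rotate_inverse_ex: "\<exists>m. rotate m (rotate n xs) = xs"
proof (induction n)
  case 0
  have "rotate 0 (rotate 0 xs) = xs" by simp
  then show ?case ..
next
  case (Suc n)
  have "\<exists>k. rotate k (rotate1 ys) = ys" for ys :: "'a list"
  proof (cases ys)
    case (Cons y zs)
    then show ?thesis
      using rotate_append[of zs "[y]"] by (intro exI[of _ "length zs"]) simp
  qed simp
  then obtain k where "rotate k (rotate (Suc n) xs) = rotate n xs" by fastforce
  with Suc show ?case by (metis rotate_rotate)
qed

lemma gauss_iso_rotate: "gauss_iso v (rotate n v)"
  by (rule gauss_isoI[of id _ _ n]) auto

lemma gauss_iso_append_commute: "gauss_iso (v @ w) (w @ v)"
  using gauss_iso_rotate[of "v @ w" "length v"] by (simp add: rotate_append)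

lemma gauss_iso_rev: "gauss_iso v (rev v)"
  by (rule gauss_isoI[of id _ _ 0]) auto

lemma gauss_iso_map: "inj_on f (set v) \<Longrightarrow> gauss_iso v (map f v)"
  by (rule gauss_isoI[of f _ _ 0]) auto

text \<open>Renaming acts on letters while rotation and reversal act on positions, so they commute.
  A reversal met halfway is moved inside a rotation, and the composite has again one of the two
  shapes allowed by \<open>gauss_iso\<close>.\<close>

lemma gauss_iso_trans:
  assumes "gauss_iso u v" and "gauss_iso v w"
  shows "gauss_iso u w"
proof -
  obtain f n where f: "inj_on f (set u)" "v = rotate n (map f u) \<or> v = rotate n (rev (map f u))"
    using assms(1) unfolding gauss_iso_def by blast
  obtain g m where g: "inj_on g (set v)" "w = rotate m (map g v) \<or> w = rotate m (rev (map g v))"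
    using assms(2) unfolding gauss_iso_def by blast
  have sv: "set v = f ` set u" using f(2) by auto
  have inj: "inj_on (g \<circ> f) (set u)" using f(1) g(1) sv by (simp add: comp_inj_on)
  have 1: "\<exists>k. map g v = rotate k (map (g \<circ> f) u) \<or> map g v = rotate k (rev (map (g \<circ> f) u))"
    using f(2) by (auto simp: rotate_map[symmetric] rev_map[symmetric])
  then have "\<exists>k. rev (map g v) = rotate k (map (g \<circ> f) u) \<or> rev (map g v) = rotate k (rev (map (g \<circ> f) u))"
    by (metis rev_rotate_ex rev_rev_ident)
  with 1 g(2) have "\<exists>k. w = rotate k (map (g \<circ> f) u) \<or> w = rotate k (rev (map (g \<circ> f) u))"
    by (metis rotate_rotate)
  with inj show ?thesis unfolding gauss_iso_def by blast
qed

lemma gauss_iso_sym: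
  assumes "gauss_iso v w"
  shows "gauss_iso w v"
proof -
  obtain f n where f: "inj_on f (set v)" "w = rotate n (map f v) \<or> w = rotate n (rev (map f v))"
    using assms unfolding gauss_iso_def by blast
  define g where "g = inv_into (set v) f"
  have sw: "set w = f ` set v" using f(2) by auto
  have inj: "inj_on g (set w)" unfolding g_def sw by (simp add: inj_on_inv_into)
  have gf: "map g (map f v) = v" using f(1) by (auto simp: g_def intro!: map_idI)
  have mw: "map g w = rotate n v \<or> map g w = rotate n (rev v)"
    using f(2) gf by (auto simp: rotate_map[symmetric] rev_map[symmetric])
  then have "\<exists>k. v = rotate k (map g w) \<or> v = rotate k (rev (map g w))"
    by (metis rotate_inverse_ex rev_rotate_ex rev_rev_ident)
  with inj show ?thesis unfolding gauss_iso_def by blast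
qed

lemma gauss_class_cong: "gauss_iso v w \<Longrightarrow> gauss_class v = gauss_class w"
  unfolding gauss_class_def using gauss_iso_trans gauss_iso_trans[OF gauss_iso_sym] by fast

lemma diagram_cong: "gauss_iso v w \<Longrightarrow> diagram v = diagram w"
  unfolding diagram_def by (simp add: gauss_class_cong)

section \<open>Classes of words over arbitrary alphabets\<close>

lemma ex_nat_labelling: "\<exists>f :: 'a \<Rightarrow> nat. inj_on f (set v)"
  by (meson finite_imp_inj_to_nat_seg List.finite_set)

lemma gauss_word_map:
  assumes "inj_on f (set v)" and "gauss_word v"
  shows "gauss_word (map f v)"
proof -
  have "count_list (map f v) (f a) = count_list v a" if "a \<in> set v" for a
    using count_list_inj_map assms(1) that by fastforce
  then show ?thesis using assms(2) unfolding gauss_word_def by auto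
qed

text \<open>Puts the class of a word over any alphabet, such as the points of a surface, into the
  carrier of \<open>chord_diagram\<close>, which is built from words over \<open>nat\<close>; this
  is what makes \<open>Abs_chord_diagram\<close> injective on such classes.\<close>

lemma gauss_class_in_range:
  assumes "gauss_word v"
  shows "gauss_class v \<in> {gauss_class v | v :: nat list. gauss_word v}"
proof -
  obtain f :: "'a \<Rightarrow> nat" where f: "inj_on f (set v)" using ex_nat_labelling by blast
  have "gauss_class v = gauss_class (map f v)" by (rule gauss_class_cong[OF gauss_iso_map[OF f]])
  then show ?thesis using gauss_word_map[OF f assms] by blast
qed

lemma diagram_eq_iff:
  assumes "gauss_word v" and "gauss_word w"
  shows "diagram v = diagram w \<longleftrightarrow> gauss_iso v w"
proof
  assume "diagram v = diagram w"
  then have eq: "gauss_class v = gauss_class w"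
    unfolding diagram_def
    using Abs_chord_diagram_inject[OF gauss_class_in_range gauss_class_in_range, OF assms] by simp
  obtain f :: "'a \<Rightarrow> nat" where f: "inj_on f (set v)" using ex_nat_labelling by blast
  \<comment> \<open>Classes have members over \<open>nat\<close> only, so the relabelled copy of
    \<open>v\<close> takes the place of \<open>v\<close> as a common member.\<close>
  have "map f v \<in> gauss_class v" using gauss_iso_map[OF f] by (simp add: gauss_class_def)
  then have "map f v \<in> gauss_class w" using eq by simp
  then have "gauss_iso w (map f v)" by (simp add: gauss_class_def)
  then show "gauss_iso v w" by (rule gauss_iso_trans[OF gauss_iso_map[OF f] gauss_iso_sym])
qed (rule diagram_cong)

text \<open>The copy over \<open>nat\<close> is a witness for the choice in
  \<open>representative\<close>, so whatever is chosen is isomorphic to \<open>v\<close>; counts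
  defined on the representative can be computed on \<open>v\<close> itself.\<close>

lemma representative_diagram:
  assumes "gauss_word v"
  shows "gauss_iso v (representative (diagram v))"
proof -
  obtain f :: "'a \<Rightarrow> nat" where f: "inj_on f (set v)" using ex_nat_labelling by blast
  have "gauss_word (map f v) \<and> diagram (map f v) = diagram v"
    using diagram_cong[OF gauss_iso_map[OF f]] gauss_word_map[OF f assms] by simp
  then have "gauss_word (representative (diagram v)) \<and> diagram (representative (diagram v)) = diagram v"
    unfolding representative_def by (rule someI)
  then show ?thesis using diagram_eq_iff[OF assms, of "representative (diagram v)"] by simp
qed

section \<open>Sub-words and sums over letter subsets\<close>

lemma filter_rotate_ex: "\<exists>m. filter p (rotate n xs) = rotate m (filter p xs)"
proof -
  obtain us vs where "xs = us @ vs" "rotate n xs = vs @ us"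
    by (metis append_take_drop_id rotate_drop_take)
  then show ?thesis by (intro exI[of _ "length (filter p us)"]) (simp add: rotate_append)
qed

text \<open>The isomorphism is spelled out instead of being hidden in \<open>gauss_iso\<close>,
  because the same \<open>f\<close> has to match the letter subsets of the two words.\<close>

lemma gauss_iso_filter:
  assumes "inj_on f (set v)" and w: "w = rotate n (map f v) \<or> w = rotate n (rev (map f v))"
    and "A \<subseteq> set v"
  shows "gauss_iso (filter (\<lambda>a. a \<in> A) v) (filter (\<lambda>a. a \<in> f ` A) w)"
proof -
  have *: "filter (\<lambda>a. a \<in> f ` A) (map f v) = map f (filter (\<lambda>a. a \<in> A) v)"
    using assms(1,3) by (auto simp: filter_map inj_on_image_mem_iff intro!: arg_cong[of _ _ "map f"] filter_cong)
  have "\<exists>m. filter (\<lambda>a. a \<in> f ` A) w = rotate m (map f (filter (\<lambda>a. a \<in> A) v)) \<or>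
            filter (\<lambda>a. a \<in> f ` A) w = rotate m (rev (map f (filter (\<lambda>a. a \<in> A) v)))"
    using w filter_rotate_ex[of "\<lambda>a. a \<in> f ` A" n "map f v"]
      filter_rotate_ex[of "\<lambda>a. a \<in> f ` A" n "rev (map f v)"] *
    by (metis rev_filter)
  moreover have "inj_on f (set (filter (\<lambda>a. a \<in> A) v))"
    using assms(1) by (rule inj_on_subset) auto
  ultimately show ?thesis unfolding gauss_iso_def by blast
qed

text \<open>With the indicator of a diagram as \<Phi> this counts sub-diagrams; with an additive
  functional restricted to generators it is the value of that functional on the formal sum of all
  sub-diagrams. Summing over letter sets rather than words makes it easy to split off single
  letters.\<close>

definition sub_sum :: "(chord_diagram \<Rightarrow> int) \<Rightarrow> 'a list \<Rightarrow> int" where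
  "sub_sum \<Phi> v = (\<Sum>A \<in> Pow (set v). \<Phi> (diagram (filter (\<lambda>a. a \<in> A) v)))"

lemma sub_sum_cong:
  assumes "gauss_iso v w"
  shows "sub_sum \<Phi> v = sub_sum \<Phi> w"
proof -
  obtain f n where f: "inj_on f (set v)" "w = rotate n (map f v) \<or> w = rotate n (rev (map f v))"
    using assms unfolding gauss_iso_def by blast
  have "set w = f ` set v" using f(2) by auto
  then have "bij_betw ((`) f) (Pow (set v)) (Pow (set w))"
    using f(1) by (simp add: bij_betw_Pow bij_betw_imageI)
  moreover have "\<Phi> (diagram (filter (\<lambda>a. a \<in> A) v)) = \<Phi> (diagram (filter (\<lambda>a. a \<in> f ` A) w))"
    if "A \<in> Pow (set v)" for A
    using diagram_cong[OF gauss_iso_filter[OF f]] that by auto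
  ultimately show ?thesis
    unfolding sub_sum_def by (simp add: sum.reindex_bij_betw[symmetric])
qed

text \<open>A sub-word determines its letter set, so no multiplicity is lost by collecting the
  sub-words in a set.\<close>

lemma card_Sub_eq_sub_sum:
  "int (card {H \<in> Sub v. diagram H = y}) = sub_sum (\<lambda>z. if z = y then 1 else 0) v"
proof -
  let ?r = "\<lambda>A. filter (\<lambda>a. a \<in> A) v"
  have inj: "inj_on ?r (Pow (set v))"
  proof (rule inj_onI)
    fix A B assume "A \<in> Pow (set v)" "B \<in> Pow (set v)" "?r A = ?r B"
    then have "set (?r A) = set (?r B)" "A \<subseteq> set v" "B \<subseteq> set v" by auto
    then show "A = B" by auto
  qed
  have "{H \<in> Sub v. diagram H = y} = ?r ` {A \<in> Pow (set v). diagram (?r A) = y}"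
    unfolding Sub_def by auto
  moreover have "inj_on ?r {A \<in> Pow (set v). diagram (?r A) = y}"
    by (rule inj_on_subset[OF inj]) auto
  ultimately have "card {H \<in> Sub v. diagram H = y} = card {A \<in> Pow (set v). diagram (?r A) = y}"
    by (simp only: card_image)
  then show ?thesis
    by (simp add: sub_sum_def sum.If_cases Int_def)
qed

lemma sub_count_diagram:
  assumes "gauss_word v"
  shows "int (sub_count y (diagram v)) = sub_sum (\<lambda>z. if z = y then 1 else 0) v"
  unfolding sub_count_def card_Sub_eq_sub_sum
  using sub_sum_cong[OF representative_diagram[OF assms]] by metis

lemma sum_Pow_insert:
  assumes "finite B" and "i \<notin> B"
  shows "(\<Sum>A \<in> Pow (insert i B). \<psi> A) = (\<Sum>A \<in> Pow B. \<psi> A + \<psi> (insert i A) :: int)"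
proof -
  have "inj_on (insert i) (Pow B)" using assms(2) by (auto simp: inj_on_def)
  moreover have "Pow B \<inter> insert i ` Pow B = {}" using assms(2) by auto
  ultimately show ?thesis
    using assms(1) by (simp add: Pow_insert sum.union_disjoint sum.reindex sum.distrib)
qed

text \<open>Handles membership in \<open>insert i A\<close> on a stretch of the word free of
  \<open>i\<close>. In this way the simplifier reduces a restricted word to restrictions of its gaps
  with the letters of the move put in place.\<close>

lemma filter_eq_or:
  "i \<notin> set S \<Longrightarrow> filter (\<lambda>a. a = i \<or> p a) S = filter p S"
  by (rule filter_cong) auto

lemma gauss_word_filter: "gauss_word v \<Longrightarrow> gauss_word (filter p v)"
  by (auto simp: gauss_word_def count_list_eq_length_filter intro!: arg_cong[of _ _ length] filter_cong
      elim!: ballE trans[rotated])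

lemma gauss_word_mset_cong: "mset v = mset w \<Longrightarrow> gauss_word v \<longleftrightarrow> gauss_word w"
  unfolding gauss_word_def by (metis count_mset mset_eq_setD)

lemma sub_sum_append_commute: "sub_sum \<Phi> (v @ w) = sub_sum \<Phi> (w @ v)"
  by (rule sub_sum_cong[OF gauss_iso_append_commute])

section \<open>Moves of Gauss words\<close>

lemma RI_relator:
  "gauss_word S \<Longrightarrow> i \<notin> set S \<Longrightarrow> gen (S @ [i, i]) \<in> relators1 RI"
  unfolding relators1.simps by blast

lemma strong_RII_relator:
  "gauss_word (S @ T) \<Longrightarrow> distinct [i, j] \<Longrightarrow> {i, j} \<inter> set (S @ T) = {} \<Longrightarrow>
   gen (S @ [i, j] @ T @ [j, i]) + gen (S @ [i] @ T @ [i]) + gen (S @ [j] @ T @ [j]) \<in> relators1 strong_RII"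
  unfolding relators1.simps by blast

lemma weak_RII_relator:
  "gauss_word (S @ T) \<Longrightarrow> distinct [i, j] \<Longrightarrow> {i, j} \<inter> set (S @ T) = {} \<Longrightarrow>
   gen (S @ [i, j] @ T @ [i, j]) + gen (S @ [i] @ T @ [i]) + gen (S @ [j] @ T @ [j]) \<in> relators1 weak_RII"
  unfolding relators1.simps by blast

lemma strong_RIII_relator:
  "gauss_word (S @ T @ U) \<Longrightarrow> distinct [i, j, k] \<Longrightarrow> {i, j, k} \<inter> set (S @ T @ U) = {} \<Longrightarrow>
   (gen (S @ [i, j] @ T @ [k, i] @ U @ [j, k]) + gen (S @ [i, j] @ T @ [i] @ U @ [j])
      + gen (S @ [i] @ T @ [k, i] @ U @ [k]) + gen (S @ [j] @ T @ [k] @ U @ [j, k]))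
    - (gen (S @ [j, i] @ T @ [i, k] @ U @ [k, j]) + gen (S @ [j, i] @ T @ [i] @ U @ [j])
      + gen (S @ [i] @ T @ [i, k] @ U @ [k]) + gen (S @ [j] @ T @ [k] @ U @ [k, j])) \<in> relators1 strong_RIII"
  unfolding relators1.simps by blast

lemma weak_RIII_relator:
  "gauss_word (S @ T @ U) \<Longrightarrow> distinct [i, j, k] \<Longrightarrow> {i, j, k} \<inter> set (S @ T @ U) = {} \<Longrightarrow>
   (gen (S @ [i, j] @ T @ [i, k] @ U @ [j, k]) + gen (S @ [i, j] @ T @ [i] @ U @ [j])
      + gen (S @ [i] @ T @ [i, k] @ U @ [k]) + gen (S @ [j] @ T @ [k] @ U @ [j, k]))
    - (gen (S @ [j, i] @ T @ [k, i] @ U @ [k, j]) + gen (S @ [j, i] @ T @ [i] @ U @ [j])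
      + gen (S @ [i] @ T @ [k, i] @ U @ [k]) + gen (S @ [j] @ T @ [k] @ U @ [k, j])) \<in> relators1 weak_RIII"
  unfolding relators1.simps by blast

lemma sum_Pow_insert2:
  assumes "finite B" and "distinct [i, j]" and "{i, j} \<inter> B = {}"
  shows "(\<Sum>A \<in> Pow (insert i (insert j B)). \<psi> A) =
    (\<Sum>A \<in> Pow B. (\<psi> A + \<psi> (insert i A)) + (\<psi> (insert j A) + \<psi> (insert i (insert j A))) :: int)"
  using assms by (simp add: sum_Pow_insert)

lemma sum_Pow_insert3:
  assumes "finite B" and "distinct [i, j, k]" and "{i, j, k} \<inter> B = {}"
  shows "(\<Sum>A \<in> Pow (insert i (insert j (insert k B))). \<psi> A) =
    (\<Sum>A \<in> Pow B. ((\<psi> A + \<psi> (insert i A)) + (\<psi> (insert j A) + \<psi> (insert i (insert j A))))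
      + ((\<psi> (insert k A) + \<psi> (insert i (insert k A)))
        + (\<psi> (insert j (insert k A)) + \<psi> (insert i (insert j (insert k A))))) :: int)"
  using assms by (simp add: sum_Pow_insert)

text \<open>Abstracts the weighted sum of dual functionals. Additivity turns vanishing on a relator
  into a relation between the values on its words.\<close>

locale relator_functional =
  fixes L :: "(chord_diagram \<Rightarrow>\<^sub>0 int) \<Rightarrow> int"
  assumes add: "L (r + s) = L r + L s"
begin

sublocale additive L
  by unfold_locales (rule add)

abbreviation sub_eval :: "'a list \<Rightarrow> int" where
  "sub_eval \<equiv> sub_sum (\<lambda>y. L (frag_of y))"

lemma sub_eval_RI:
  fixes S :: "nat list"
  assumes L0: "\<And>r. r \<in> relators1 RI \<Longrightarrow> L r = 0"
    and "gauss_word S" and i: "i \<notin> set S"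
  shows "sub_eval (S @ [i, i]) = sub_eval S"
proof -
  \<comment> \<open>Subsets containing \<open>i\<close> restrict the word to a relator of type (I),
    so the subsets of the letters of \<open>S\<close> alone contribute.\<close>
  have "L (gen (filter p S @ [i, i])) = 0" for p
    using gauss_word_filter[OF assms(2)] i by (intro L0 RI_relator) auto
  moreover have "set (S @ [i, i]) = insert i (set S)" by simp
  ultimately show ?thesis
    unfolding sub_sum_def
    using i by (auto simp: sum_Pow_insert filter_eq_or intro!: sum.cong)
qed

lemma sub_eval_strong_RII:
  fixes S T :: "nat list"
  assumes L0: "\<And>r. r \<in> relators1 strong_RII \<Longrightarrow> L r = 0"
    and g: "gauss_word (S @ T)" and d: "distinct [i, j]" and n: "{i, j} \<inter> set (S @ T) = {}"
  shows "sub_eval (S @ [i, j] @ T @ [j, i]) = sub_eval (S @ T)"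
proof -
  \<comment> \<open>Of the four ways in which a subset can meet \<open>{i, j}\<close>, the three
    nonempty ones add up to a relator for the restricted gaps; the empty one leaves a sub-word of
    \<open>S @ T\<close>.\<close>
  have "L (gen (filter p S @ [i, j] @ filter p T @ [j, i]))
      + L (gen (filter p S @ [i] @ filter p T @ [i]))
      + L (gen (filter p S @ [j] @ filter p T @ [j])) = 0" for p
    unfolding add[symmetric]
    using gauss_word_filter[OF g, of p] d n by (intro L0 strong_RII_relator) auto
  moreover have "set (S @ [i, j] @ T @ [j, i]) = insert i (insert j (set (S @ T)))" by auto
  ultimately show ?thesis
    unfolding sub_sum_def
    using sum_Pow_insert2[OF _ d n] d n
    by (auto simp: filter_eq_or add.assoc algebra_simps intro!: sum.cong)
qed

lemma sub_eval_weak_RII: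
  fixes S T :: "nat list"
  assumes L0: "\<And>r. r \<in> relators1 weak_RII \<Longrightarrow> L r = 0"
    and g: "gauss_word (S @ T)" and d: "distinct [i, j]" and n: "{i, j} \<inter> set (S @ T) = {}"
  shows "sub_eval (S @ [i, j] @ T @ [i, j]) = sub_eval (S @ T)"
proof -
  have "L (gen (filter p S @ [i, j] @ filter p T @ [i, j]))
      + L (gen (filter p S @ [i] @ filter p T @ [i]))
      + L (gen (filter p S @ [j] @ filter p T @ [j])) = 0" for p
    unfolding add[symmetric]
    using gauss_word_filter[OF g, of p] d n by (intro L0 weak_RII_relator) auto
  moreover have "set (S @ [i, j] @ T @ [i, j]) = insert i (insert j (set (S @ T)))" by auto
  ultimately show ?thesis
    unfolding sub_sum_def
    using sum_Pow_insert2[OF _ d n] d n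
    by (auto simp: filter_eq_or add.assoc algebra_simps intro!: sum.cong)
qed

lemma sub_eval_strong_RIII:
  fixes S T U :: "nat list"
  assumes L0: "\<And>r. r \<in> relators1 strong_RIII \<Longrightarrow> L r = 0"
    and g: "gauss_word (S @ T @ U)" and d: "distinct [i, j, k]" and n: "{i, j, k} \<inter> set (S @ T @ U) = {}"
  shows "sub_eval (S @ [i, j] @ T @ [k, i] @ U @ [j, k]) = sub_eval (S @ [j, i] @ T @ [i, k] @ U @ [k, j])"
proof -
  \<comment> \<open>Each arc carries two different crossings, so a subset with at most one of
    \<open>i\<close>, \<open>j\<close>, \<open>k\<close> sees no order reversed and yields the same
    word on both sides. The other four combinations form the two brackets of the relator.\<close>
  have "(L (gen (filter p S @ [i, j] @ filter p T @ [k, i] @ filter p U @ [j, k]))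
      + L (gen (filter p S @ [i, j] @ filter p T @ [i] @ filter p U @ [j]))
      + L (gen (filter p S @ [i] @ filter p T @ [k, i] @ filter p U @ [k]))
      + L (gen (filter p S @ [j] @ filter p T @ [k] @ filter p U @ [j, k])))
    - (L (gen (filter p S @ [j, i] @ filter p T @ [i, k] @ filter p U @ [k, j]))
      + L (gen (filter p S @ [j, i] @ filter p T @ [i] @ filter p U @ [j]))
      + L (gen (filter p S @ [i] @ filter p T @ [i, k] @ filter p U @ [k]))
      + L (gen (filter p S @ [j] @ filter p T @ [k] @ filter p U @ [k, j]))) = 0" for p
    unfolding add[symmetric] diff[symmetric]
    using gauss_word_filter[OF g, of p] d n by (intro L0 strong_RIII_relator) auto
  moreover have "set (S @ [i, j] @ T @ [k, i] @ U @ [j, k]) = insert i (insert j (insert k (set (S @ T @ U))))"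
    "set (S @ [j, i] @ T @ [i, k] @ U @ [k, j]) = insert i (insert j (insert k (set (S @ T @ U))))"
    by auto
  ultimately show ?thesis
    unfolding sub_sum_def
    using sum_Pow_insert3[OF _ d n] d n
    by (auto simp: filter_eq_or algebra_simps intro!: sum.cong)
qed

lemma sub_eval_weak_RIII:
  fixes S T U :: "nat list"
  assumes L0: "\<And>r. r \<in> relators1 weak_RIII \<Longrightarrow> L r = 0"
    and g: "gauss_word (S @ T @ U)" and d: "distinct [i, j, k]" and n: "{i, j, k} \<inter> set (S @ T @ U) = {}"
  shows "sub_eval (S @ [i, j] @ T @ [i, k] @ U @ [j, k]) = sub_eval (S @ [j, i] @ T @ [k, i] @ U @ [k, j])"
proof -
  have "(L (gen (filter p S @ [i, j] @ filter p T @ [i, k] @ filter p U @ [j, k]))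
      + L (gen (filter p S @ [i, j] @ filter p T @ [i] @ filter p U @ [j]))
      + L (gen (filter p S @ [i] @ filter p T @ [i, k] @ filter p U @ [k]))
      + L (gen (filter p S @ [j] @ filter p T @ [k] @ filter p U @ [j, k])))
    - (L (gen (filter p S @ [j, i] @ filter p T @ [k, i] @ filter p U @ [k, j]))
      + L (gen (filter p S @ [j, i] @ filter p T @ [i] @ filter p U @ [j]))
      + L (gen (filter p S @ [i] @ filter p T @ [k, i] @ filter p U @ [k]))
      + L (gen (filter p S @ [j] @ filter p T @ [k] @ filter p U @ [k, j]))) = 0" for p
    unfolding add[symmetric] diff[symmetric]
    using gauss_word_filter[OF g, of p] d n by (intro L0 weak_RIII_relator) auto
  moreover have "set (S @ [i, j] @ T @ [i, k] @ U @ [j, k]) = insert i (insert j (insert k (set (S @ T @ U))))"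
    "set (S @ [j, i] @ T @ [k, i] @ U @ [k, j]) = insert i (insert j (insert k (set (S @ T @ U))))"
    by auto
  ultimately show ?thesis
    unfolding sub_sum_def
    using sum_Pow_insert3[OF _ d n] d n
    by (auto simp: filter_eq_or algebra_simps intro!: sum.cong)
qed

text \<open>RIII reverses the order of the two crossings on each of its three arcs.\<close>

definition exchanges :: "nat list \<Rightarrow> nat list \<Rightarrow> nat list \<Rightarrow> bool" where
  "exchanges p q r \<longleftrightarrow>
     (\<forall>S T U V. gauss_word (S @ T @ U @ V) \<and> set (p @ q @ r) \<inter> set (S @ T @ U @ V) = {} \<longrightarrow>
        sub_eval (S @ p @ T @ q @ U @ r @ V) = sub_eval (S @ rev p @ T @ rev q @ U @ rev r @ V))"

text \<open>Moving the last passage and its trailing gap to the front is a rotation of the word; the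
  outer gaps \<open>V\<close> and \<open>S\<close> merge, and the gap before \<open>p\<close>
  becomes empty.\<close>

lemma exchanges_rotate:
  assumes "exchanges p q r"
  shows "exchanges q r p"
  unfolding exchanges_def
proof (intro allI impI; elim conjE)
  fix S T U V :: "nat list"
  assume g: "gauss_word (S @ T @ U @ V)" and n: "set (q @ r @ p) \<inter> set (S @ T @ U @ V) = {}"
  have "gauss_word ([] @ (V @ S) @ T @ U)"
    using g by (subst gauss_word_mset_cong[of _ "S @ T @ U @ V"]) auto
  then have "sub_eval ([] @ p @ (V @ S) @ q @ T @ r @ U) = sub_eval ([] @ rev p @ (V @ S) @ rev q @ T @ rev r @ U)"
    using n by (intro assms[unfolded exchanges_def, rule_format]) auto
  then show "sub_eval (S @ q @ T @ r @ U @ p @ V) = sub_eval (S @ rev q @ T @ rev r @ U @ rev p @ V)"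
    using sub_sum_append_commute[of _ "S @ q @ T @ r @ U" "p @ V"]
      sub_sum_append_commute[of _ "S @ rev q @ T @ rev r @ U" "rev p @ V"] by simp
qed

lemma exchanges_rev: "exchanges p q r \<Longrightarrow> exchanges (rev p) (rev q) (rev r)"
  unfolding exchanges_def by auto

text \<open>Words of a relator end with their last passage, while a based word of a curve continues
  after it; rotation merges this final gap with the initial one.\<close>

lemma exchanges_base:
  assumes "\<And>S T U. gauss_word (S @ T @ U) \<Longrightarrow> set (p @ q @ r) \<inter> set (S @ T @ U) = {} \<Longrightarrow>
     sub_eval (S @ p @ T @ q @ U @ r) = sub_eval (S @ rev p @ T @ rev q @ U @ rev r)"
  shows "exchanges p q r"
  unfolding exchanges_def
proof (intro allI impI; elim conjE)
  fix S T U V :: "nat list"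
  assume g: "gauss_word (S @ T @ U @ V)" and n: "set (p @ q @ r) \<inter> set (S @ T @ U @ V) = {}"
  have "gauss_word ((V @ S) @ T @ U)"
    using g by (subst gauss_word_mset_cong[of _ "S @ T @ U @ V"]) auto
  then have "sub_eval ((V @ S) @ p @ T @ q @ U @ r) = sub_eval ((V @ S) @ rev p @ T @ rev q @ U @ rev r)"
    using n by (intro assms) auto
  then show "sub_eval (S @ p @ T @ q @ U @ r @ V) = sub_eval (S @ rev p @ T @ rev q @ U @ rev r @ V)"
    using sub_sum_append_commute[of _ "S @ p @ T @ q @ U @ r" V]
      sub_sum_append_commute[of _ "S @ rev p @ T @ rev q @ U @ rev r" V] by simp
qed

lemma exchanges_strong:
  assumes "\<And>r. r \<in> relators1 strong_RIII \<Longrightarrow> L r = 0" and "distinct [i, j, k]"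
  shows "exchanges [i, j] [k, i] [j, k]"
  using sub_eval_strong_RIII[OF assms(1) _ assms(2)] by (intro exchanges_base) auto

lemma exchanges_weak:
  assumes "\<And>r. r \<in> relators1 weak_RIII \<Longrightarrow> L r = 0" and "distinct [i, j, k]"
  shows "exchanges [i, j] [i, k] [j, k]"
  using sub_eval_weak_RIII[OF assms(1) _ assms(2)] by (intro exchanges_base) auto

text \<open>The gap \<open>T\<close> separates the two visits to a bigon. Taking \<open>q\<close>
  empty lets the kink of RI fit the same format.\<close>

definition removable :: "nat list \<Rightarrow> nat list \<Rightarrow> bool" where
  "removable p q \<longleftrightarrow>
     (\<forall>S T U. gauss_word (S @ T @ U) \<and> set (p @ q) \<inter> set (S @ T @ U) = {} \<longrightarrow>
        sub_eval (S @ p @ T @ q @ U) = sub_eval (S @ T @ U))"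

lemma removable_base:
  assumes "\<And>S T. gauss_word (S @ T) \<Longrightarrow> set (p @ q) \<inter> set (S @ T) = {} \<Longrightarrow>
     sub_eval (S @ p @ T @ q) = sub_eval (S @ T)"
  shows "removable p q"
  unfolding removable_def
proof (intro allI impI; elim conjE)
  fix S T U :: "nat list"
  assume g: "gauss_word (S @ T @ U)" and n: "set (p @ q) \<inter> set (S @ T @ U) = {}"
  have "gauss_word ((U @ S) @ T)"
    using g by (subst gauss_word_mset_cong[of _ "S @ T @ U"]) auto
  then have "sub_eval ((U @ S) @ p @ T @ q) = sub_eval ((U @ S) @ T)"
    using n by (intro assms) auto
  then show "sub_eval (S @ p @ T @ q @ U) = sub_eval (S @ T @ U)"
    using sub_sum_append_commute[of _ "S @ p @ T @ q" U] sub_sum_append_commute[of _ "S @ T" U] by simp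
qed

lemma removable_strong:
  assumes "\<And>r. r \<in> relators1 strong_RII \<Longrightarrow> L r = 0" and "distinct [i, j]"
  shows "removable [i, j] [j, i]"
  using sub_eval_strong_RII[OF assms(1) _ assms(2)] by (intro removable_base) auto

lemma removable_weak:
  assumes "\<And>r. r \<in> relators1 weak_RII \<Longrightarrow> L r = 0" and "distinct [i, j]"
  shows "removable [i, j] [i, j]"
  using sub_eval_weak_RII[OF assms(1) _ assms(2)] by (intro removable_base) auto

end

section \<open>Transport to letters of arbitrary type\<close>

lemma ex_relabelling:
  fixes c :: "nat \<Rightarrow> 'a" and e :: "'a \<Rightarrow> nat"
  assumes e: "inj_on e B" and c: "inj_on c {..<n}" and B: "c ` {..<n} \<inter> B = {}"
  shows "\<exists>f. inj_on f (B \<union> c ` {..<n}) \<and> (\<forall>i<n. f (c i) = i) \<and> (\<forall>y\<in>B. f y = n + e y)"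
proof -
  \<comment> \<open>Crossings return to their indices, as in the patterns over \<open>nat\<close>;
    all other letters are shifted by \<open>n\<close> so that they cannot collide with these
    indices.\<close>
  define f where "f y = (if y \<in> B then n + e y else inv_into {..<n} c y)" for y
  have 1: "f (c i) = i" if "i < n" for i using that B c by (auto simp: f_def)
  have 2: "f y = n + e y" if "y \<in> B" for y using that by (simp add: f_def)
  have "inj_on f (B \<union> c ` {..<n})"
  proof (rule inj_onI)
    fix y z assume "y \<in> B \<union> c ` {..<n}" "z \<in> B \<union> c ` {..<n}" "f y = f z"
    then show "y = z" using 1 2 e by (fastforce dest: inj_onD)
  qed
  with 1 2 show ?thesis by blast
qed

context relator_functional
begin

text \<open>\<open>c\<close> and \<open>c'\<close> name the crossings on the two sides of the move,
  in general different points. Each side is relabelled by its own map, but the images of the gaps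
  agree, so \<open>exchanges\<close> compares the results.\<close>

lemma sub_eval_exchange:
  fixes S T U V :: "'a list"
  assumes ex: "exchanges p q r" and n: "set (p @ q @ r) \<subseteq> {..<n}"
    and g: "gauss_word (S @ T @ U @ V)"
    and c: "inj_on c {..<n}" "c ` {..<n} \<inter> set (S @ T @ U @ V) = {}"
    and c': "inj_on c' {..<n}" "c' ` {..<n} \<inter> set (S @ T @ U @ V) = {}"
  shows "sub_eval (S @ map c p @ T @ map c q @ U @ map c r @ V) =
         sub_eval (S @ map c' (rev p) @ T @ map c' (rev q) @ U @ map c' (rev r) @ V)"
proof -
  let ?B = "set (S @ T @ U @ V)"
  obtain e :: "'a \<Rightarrow> nat" where e: "inj_on e ?B" using ex_nat_labelling by blast
  let ?e = "\<lambda>y. n + e y"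
  have *: "sub_eval (S @ map d p' @ T @ map d q' @ U @ map d r' @ V) =
      sub_eval (map ?e S @ p' @ map ?e T @ q' @ map ?e U @ r' @ map ?e V)"
    if d: "inj_on d {..<n}" "d ` {..<n} \<inter> ?B = {}" and n': "set (p' @ q' @ r') \<subseteq> {..<n}" for d p' q' r'
  proof -
    obtain f where f: "inj_on f (?B \<union> d ` {..<n})" "\<forall>i<n. f (d i) = i" "\<forall>y\<in>?B. f y = n + e y"
      using ex_relabelling[OF e d] by blast
    have m: "map f (map d l) = l" if "set l \<subseteq> {..<n}" for l
      using that f(2) by (auto intro!: map_idI)
    have m': "map f S = map ?e S" "map f T = map ?e T" "map f U = map ?e U" "map f V = map ?e V"
      using f(3) by simp_all
    have "inj_on f (set (S @ map d p' @ T @ map d q' @ U @ map d r' @ V))"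
      using n' by (intro inj_on_subset[OF f(1)]) auto
    from sub_sum_cong[OF gauss_iso_map[OF this]] show ?thesis
      using m[of p'] m[of q'] m[of r'] m' n' by (simp del: map_map map_eq_conv)
  qed
  have "gauss_word (map ?e (S @ T @ U @ V))"
    using e g by (intro gauss_word_map) (auto simp: inj_on_def)
  then have "sub_eval (map ?e S @ p @ map ?e T @ q @ map ?e U @ r @ map ?e V) =
      sub_eval (map ?e S @ rev p @ map ?e T @ rev q @ map ?e U @ rev r @ map ?e V)"
    using n by (intro ex[unfolded exchanges_def, rule_format]) auto
  then show ?thesis using *[OF c, of p q r] *[OF c', of "rev p" "rev q" "rev r"] n by simp
qed

lemma sub_eval_remove:
  fixes S T U :: "'a list"
  assumes re: "removable p q" and n: "set (p @ q) \<subseteq> {..<n}"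
    and g: "gauss_word (S @ T @ U)"
    and c: "inj_on c {..<n}" "c ` {..<n} \<inter> set (S @ T @ U) = {}"
  shows "sub_eval (S @ map c p @ T @ map c q @ U) = sub_eval (S @ T @ U)"
proof -
  let ?B = "set (S @ T @ U)"
  obtain e :: "'a \<Rightarrow> nat" where e: "inj_on e ?B" using ex_nat_labelling by blast
  let ?e = "\<lambda>y. n + e y"
  obtain f where f: "inj_on f (?B \<union> c ` {..<n})" "\<forall>i<n. f (c i) = i" "\<forall>y\<in>?B. f y = n + e y"
    using ex_relabelling[OF e c] by blast
  have m: "map f (map c l) = l" if "set l \<subseteq> {..<n}" for l
    using that f(2) by (auto intro!: map_idI)
  have m': "map f S = map ?e S" "map f T = map ?e T" "map f U = map ?e U"
    using f(3) by simp_all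
  have "inj_on f (set (S @ map c p @ T @ map c q @ U))" "inj_on f (set (S @ T @ U))"
    using n by (auto intro!: inj_on_subset[OF f(1)])
  note this[THEN gauss_iso_map, THEN sub_sum_cong, where \<Phi>="\<lambda>y. L (frag_of y)"]
  moreover have "gauss_word (map ?e (S @ T @ U))"
    using e g by (intro gauss_word_map) (auto simp: inj_on_def)
  then have "sub_eval (map ?e S @ p @ map ?e T @ q @ map ?e U) =
      sub_eval (map ?e S @ map ?e T @ map ?e U)"
    using n by (intro re[unfolded removable_def, rule_format]) auto
  ultimately show ?thesis
    using m[of p] m[of q] m' n by (simp del: map_map map_eq_conv)
qed

lemma removable_RI:
  assumes "\<And>r. r \<in> relators1 RI \<Longrightarrow> L r = 0"
  shows "removable [i, i] []"
  unfolding removable_def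
proof (intro allI impI; elim conjE)
  fix S T U :: "nat list"
  assume g: "gauss_word (S @ T @ U)" and n: "set ([i, i] @ []) \<inter> set (S @ T @ U) = {}"
  have "gauss_word (T @ U @ S)"
    using g by (subst gauss_word_mset_cong[of _ "S @ T @ U"]) auto
  then show "sub_eval (S @ [i, i] @ T @ [] @ U) = sub_eval (S @ T @ U)"
    using sub_eval_RI[OF assms, of "T @ U @ S" i] n sub_sum_append_commute[of _ S "T @ U"]
      sub_sum_append_commute[of _ "S @ [i, i]" "T @ U"] by auto
qed

end

section \<open>The image of an immersion determines its Gauss word\<close>

lemma sorted_list_of_set_eqI:
  "sorted xs \<Longrightarrow> distinct xs \<Longrightarrow> set xs = A \<Longrightarrow> sorted_list_of_set A = xs"
  by (metis sorted_list_of_set.idem_if_sorted_distinct)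

lemma sorted_list_of_set_append:
  fixes A B :: "'a::linorder set"
  assumes "finite A" and "finite B" and "\<And>a b. a \<in> A \<Longrightarrow> b \<in> B \<Longrightarrow> a < b"
  shows "sorted_list_of_set (A \<union> B) = sorted_list_of_set A @ sorted_list_of_set B"
proof -
  have "a < b" if "a \<in> set (sorted_list_of_set A)" "b \<in> set (sorted_list_of_set B)" for a b
    using that assms by simp
  moreover have "A \<inter> B = {}" using assms(3) by force
  ultimately show ?thesis
    using assms by (intro sorted_list_of_set_eqI) (auto simp: sorted_append less_imp_le)
qed

lemma sorted_list_of_set_strict_mono_image:
  fixes f :: "'a::linorder \<Rightarrow> 'b::linorder"
  assumes "finite A" and "strict_mono_on A f"
  shows "sorted_list_of_set (f ` A) = map f (sorted_list_of_set A)"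
proof (rule sorted_list_of_set_eqI)
  have "f x \<le> f y" if "x \<in> A" "y \<in> A" "x \<le> y" for x y
    using monotone_onD[OF assms(2) that(1,2)] that(3) by (cases "x = y") (auto simp: less_imp_le)
  then have "sorted_wrt (\<lambda>x y. f x \<le> f y) (sorted_list_of_set A)"
    using assms(1) by (intro sorted_wrt_mono_rel[OF _ sorted_sorted_list_of_set]) simp
  then show "sorted (map f (sorted_list_of_set A))"
    by (simp add: sorted_wrt_map)
  show "distinct (map f (sorted_list_of_set A))"
    using assms strict_mono_on_imp_inj_on by (simp add: distinct_map)
qed (use assms in simp)

lemma sorted_list_of_set_strict_antimono_image:
  fixes f :: "'a::linorder \<Rightarrow> 'b::linorder"
  assumes "finite A" and "strict_antimono_on A f"
  shows "sorted_list_of_set (f ` A) = rev (map f (sorted_list_of_set A))"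
proof (rule sorted_list_of_set_eqI)
  have "f y \<le> f x" if "x \<in> A" "y \<in> A" "x \<le> y" for x y
    using monotone_onD[OF assms(2) that(1,2)] that(3) by (cases "x = y") (auto simp: less_imp_le)
  then have "sorted_wrt (\<lambda>x y. f y \<le> f x) (sorted_list_of_set A)"
    using assms(1) by (intro sorted_wrt_mono_rel[OF _ sorted_sorted_list_of_set]) simp
  then show "sorted (rev (map f (sorted_list_of_set A)))"
    by (simp add: sorted_wrt_rev sorted_wrt_map)
  show "distinct (rev (map f (sorted_list_of_set A)))"
    using assms by (force simp: distinct_map monotone_on_def intro: linorder_inj_onI')
qed (use assms in simp)

section \<open>Periodicity and double points of generic immersions\<close>

lemma generic_immersionD:
  assumes "generic_immersion M g"
  shows "range g \<subseteq> M" and "g (t + 1) = g t"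
    and "(g has_vector_derivative vector_derivative g (at t)) (at t)"
    and "continuous_on UNIV (\<lambda>t. vector_derivative g (at t))"
    and "vector_derivative g (at t) \<noteq> 0"
    and "finite (double_times g)"
    and "continuous_on A g"
proof -
  show "range g \<subseteq> M" "g (t + 1) = g t" "vector_derivative g (at t) \<noteq> 0" "finite (double_times g)"
    using assms unfolding generic_immersion_def by blast+
  have "g C1_differentiable_on UNIV" using assms unfolding generic_immersion_def by blast
  then have d: "\<And>t. g differentiable at t"
    and "continuous_on UNIV (\<lambda>t. vector_derivative g (at t))"
    unfolding C1_differentiable_on_eq by blast+
  then show "(g has_vector_derivative vector_derivative g (at t)) (at t)"
    "continuous_on UNIV (\<lambda>t. vector_derivative g (at t))"
    by (simp_all add: vector_derivative_works[symmetric])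
  show "continuous_on A g"
    using d by (intro continuous_at_imp_continuous_on ballI differentiable_imp_continuous_within)
qed

lemma generic_immersion_triple:
  assumes "generic_immersion M g" and "r \<in> {0..<1}" "s \<in> {0..<1}" "t \<in> {0..<1}"
    and "g r = g s" "g s = g t"
  shows "r = s \<or> s = t \<or> r = t"
  using assms unfolding generic_immersion_def by blast

lemma generic_immersion_transverse:
  assumes "generic_immersion M g" and "s \<in> {0..<1}" "t \<in> {0..<1}" and "g s = g t"
    and "vector_derivative g (at s) \<in> span {vector_derivative g (at t)}"
  shows "s = t"
  using assms unfolding generic_immersion_def by blast

lemma periodic_of_int:
  fixes g :: "real \<Rightarrow> 'a"
  assumes "\<And>t. g (t + 1) = g t"
  shows "g (t + of_int k) = g t"
proof (induction k rule: int_induct[of _ 0])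
  case (step1 i)
  then show ?case using assms[of "t + of_int i"] by (simp add: add.assoc)
next
  case (step2 i)
  then show ?case using assms[of "t + of_int (i - 1)"] by (simp add: add.assoc)
qed simp

lemma periodic_frac:
  fixes g :: "real \<Rightarrow> 'a"
  assumes "\<And>t. g (t + 1) = g t"
  shows "g (frac t) = g t"
  using periodic_of_int[of g "frac t" "\<lfloor>t\<rfloor>", OF assms] by (simp add: frac_def)

lemma gauss_word_word_of:
  assumes g: "generic_immersion M g"
  shows "gauss_word (word_of g)"
  unfolding gauss_word_def
proof
  fix p assume "p \<in> set (word_of g)"
  then obtain t where t: "t \<in> double_times g" "p = g t"
    using generic_immersionD(6)[OF g] by (auto simp: word_of_def)
  then obtain s where s: "s \<in> {0..<1}" "s \<noteq> t" "g s = g t" and t': "t \<in> {0..<1}"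
    by (auto simp: double_times_def)
  \<comment> \<open>A second time exists because \<open>t\<close> is a double time, and the absence
    of triple points excludes a third.\<close>
  have "{r \<in> double_times g. g r = p} = {s, t}"
  proof
    show "{r \<in> double_times g. g r = p} \<subseteq> {s, t}"
      using generic_immersion_triple[OF g _ s(1) t'] s t by (auto simp: double_times_def)
    show "{s, t} \<subseteq> {r \<in> double_times g. g r = p}"
      using s t t' by (force simp: double_times_def)
  qed
  moreover have "count_list (word_of g) p = card {r \<in> double_times g. g r = p}"
    using generic_immersionD(6)[OF g]
    by (simp add: word_of_def count_list_eq_length_filter filter_map o_def distinct_length_filter
        Int_def conj_commute eq_commute)
  ultimately show "count_list (word_of g) p = 2" using s(2) by simp
qed

text \<open>Parallelism is stated as equality in the Cauchy-Schwarz inequality, since this is a closed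
  condition: it makes the graph of the change of parameter closed.\<close>

definition parallel :: "'a::real_inner \<Rightarrow> 'a \<Rightarrow> bool" where
  "parallel u v \<longleftrightarrow> \<bar>u \<bullet> v\<bar> = norm u * norm v"

lemma parallel_commute: "parallel u v \<longleftrightarrow> parallel v u"
  by (simp add: parallel_def inner_commute mult.commute)

lemma parallel_imp_scaleR:
  assumes "parallel u v" and "u \<noteq> 0"
  shows "\<exists>c. v = c *\<^sub>R u"
proof -
  have "norm u *\<^sub>R v = norm v *\<^sub>R u \<or> norm u *\<^sub>R v = - norm v *\<^sub>R u"
    using assms(1) norm_cauchy_schwarz_abs_eq[of u v] unfolding parallel_def by auto
  then have "inverse (norm u) *\<^sub>R (norm u *\<^sub>R v) = inverse (norm u) *\<^sub>R (norm v *\<^sub>R u) \<or>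
      inverse (norm u) *\<^sub>R (norm u *\<^sub>R v) = inverse (norm u) *\<^sub>R (- norm v *\<^sub>R u)" by metis
  then show ?thesis using assms(2) by (auto simp flip: scaleR_minus_left)
qed

lemma parallel_imp_span:
  assumes "parallel u v" "parallel u w" and "u \<noteq> 0" "w \<noteq> 0"
  shows "v \<in> span {w}"
proof -
  obtain a b where "v = a *\<^sub>R u" "w = b *\<^sub>R u"
    using parallel_imp_scaleR assms by metis
  moreover from this have "b \<noteq> 0" using assms(4) by auto
  ultimately have "v = (a / b) *\<^sub>R w" by simp
  then show ?thesis by (simp add: span_base span_scale)
qed

section \<open>Lifting points together with tangent lines\<close>

lemma has_vector_derivative_sequentially:
  assumes "(f has_vector_derivative D) (at x)" and "filterlim y (at x) sequentially"
  shows "(\<lambda>n. (f (y n) - f x) /\<^sub>R (y n - x)) \<longlonglongrightarrow> D"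
proof -
  have "((\<lambda>s. norm ((f s - f x) - (s - x) *\<^sub>R D) / norm (s - x)) \<longlongrightarrow> 0) (at x)"
    using assms(1) unfolding has_vector_derivative_def has_derivative_iff_norm by blast
  moreover have "\<forall>\<^sub>F s in at x. norm ((f s - f x) - (s - x) *\<^sub>R D) / norm (s - x) = norm ((f s - f x) /\<^sub>R (s - x) - D)"
  proof (rule eventually_at_filter[THEN iffD2], rule always_eventually, intro allI impI)
    fix s assume "s \<noteq> x"
    then have "(f s - f x) /\<^sub>R (s - x) - D = ((f s - f x) - (s - x) *\<^sub>R D) /\<^sub>R (s - x)"
      by (simp add: scaleR_diff_right)
    then show "norm ((f s - f x) - (s - x) *\<^sub>R D) / norm (s - x) = norm ((f s - f x) /\<^sub>R (s - x) - D)"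
      by (simp add: divide_inverse mult.commute)
  qed
  ultimately have "((\<lambda>s. norm ((f s - f x) /\<^sub>R (s - x) - D)) \<longlongrightarrow> 0) (at x)"
    by (simp add: tendsto_cong)
  then have "((\<lambda>s. (f s - f x) /\<^sub>R (s - x)) \<longlongrightarrow> D) (at x)"
    using LIM_zero_cancel tendsto_norm_zero_iff by blast
  then show ?thesis using assms(2) by (rule filterlim_compose)
qed

lemma has_vector_derivative_translate:
  "(g has_vector_derivative D) (at (t + c)) \<Longrightarrow> ((\<lambda>t. g (t + c)) has_vector_derivative D) (at t)" for t c :: real
  using vector_diff_chain_at[of "\<lambda>t. t + c" 1 t g D] by (simp add: o_def has_vector_derivative_add_const)

text \<open>A position may be attained at two times of \<open>g\<close>, so points of
  \<open>g'\<close> close to \<open>g' t\<close> are lifted and compactness picks the branch. Both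
  parametrizations then have the same chords from the limit point; their difference quotients are
  parallel, and parallelism passes to the limit.\<close>

lemma ex_parallel_lift:
  fixes g g' :: "real \<Rightarrow> 'a::euclidean_space"
  assumes g: "generic_immersion M g" and g': "generic_immersion M' g'"
    and range: "range g' \<subseteq> range g"
  shows "\<exists>s \<in> {0..<1}. g s = g' t \<and> parallel (vector_derivative g (at s)) (vector_derivative g' (at t))"
proof -
  note per = generic_immersionD(2)[OF g]
  define y where "y n = t + inverse (real (Suc n))" for n
  have y: "filterlim y (at t) sequentially"
    unfolding filterlim_at y_def using tendsto_add[OF tendsto_const LIMSEQ_inverse_real_of_nat, of t] by simp
  have "\<exists>s \<in> {0..1}. g s = g' (y n)" for n
  proof -
    obtain u where "g u = g' (y n)" using range by (metis imageE rangeI subsetD)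
    then have "g (frac u) = g' (y n)" using periodic_frac[of g, OF per] by simp
    moreover have "frac u \<in> {0..1}" using frac_lt_1[of u] by (simp add: less_imp_le)
    ultimately show ?thesis by blast
  qed
  then obtain x where x: "\<And>n. x n \<in> {0..1}" "\<And>n. g (x n) = g' (y n)" by metis
  obtain l r where l: "l \<in> {0..1}" and r: "strict_mono r" and xl: "(x \<circ> r) \<longlonglongrightarrow> l"
    using compact_Icc[of "0::real" 1] x(1) unfolding compact_eq_seq_compact_metric seq_compact_def by metis
  have yr: "filterlim (y \<circ> r) (at t) sequentially"
    using y r filterlim_subseq filterlim_compose unfolding o_def by blast
  have yt: "(y \<circ> r) \<longlonglongrightarrow> t" using yr unfolding filterlim_at by blast
  have ct: "isCont g l" "isCont g' t"
    using generic_immersionD(7)[OF g, of UNIV] generic_immersionD(7)[OF g', of UNIV]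
    by (auto simp: continuous_on_eq_continuous_at)
  have eq: "g ((x \<circ> r) n) = g' ((y \<circ> r) n)" for n using x(2) by simp
  have gl: "g l = g' t"
    by (rule LIMSEQ_unique[OF isCont_tendsto_compose[OF ct(1) xl]])
      (unfold eq, rule isCont_tendsto_compose[OF ct(2) yt])
  let ?u = "vector_derivative g (at l)" and ?v = "vector_derivative g' (at t)"
  \<comment> \<open>The common chord, of which both difference quotients are multiples.\<close>
  define d where "d n = g' ((y \<circ> r) n) - g' t" for n
  have v: "(\<lambda>n. d n /\<^sub>R ((y \<circ> r) n - t)) \<longlonglongrightarrow> ?v"
    unfolding d_def
    by (rule has_vector_derivative_sequentially[OF generic_immersionD(3)[OF g'] yr])
  have "\<forall>\<^sub>F n in sequentially. d n /\<^sub>R ((y \<circ> r) n - t) \<noteq> 0"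
    using v generic_immersionD(5)[OF g'] tendsto_imp_eventually_ne by blast
  then have "\<forall>\<^sub>F n in sequentially. (x \<circ> r) n \<noteq> l"
    by eventually_elim (use gl x(2) in \<open>auto simp: d_def\<close>)
  \<comment> \<open>Difference quotients of \<open>g\<close> at \<open>l\<close> require times other
    than \<open>l\<close>. The nonzero velocity of \<open>g'\<close> provides them, since it keeps
    the chord from vanishing.\<close>
  then have "filterlim (x \<circ> r) (at l) sequentially" using xl by (simp add: filterlim_at)
  from has_vector_derivative_sequentially[OF generic_immersionD(3)[OF g] this]
  have u: "(\<lambda>n. d n /\<^sub>R ((x \<circ> r) n - l)) \<longlonglongrightarrow> ?u"
    using gl x(2) by (simp add: d_def)
  have "(\<lambda>n. \<bar>(d n /\<^sub>R ((x \<circ> r) n - l)) \<bullet> (d n /\<^sub>R ((y \<circ> r) n - t))\<bar>) \<longlonglongrightarrow> \<bar>?u \<bullet> ?v\<bar>"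
    by (intro tendsto_intros u v)
  moreover have "(\<lambda>n. norm (d n /\<^sub>R ((x \<circ> r) n - l)) * norm (d n /\<^sub>R ((y \<circ> r) n - t))) \<longlonglongrightarrow> norm ?u * norm ?v"
    by (intro tendsto_intros u v)
  moreover have "\<bar>(a *\<^sub>R z) \<bullet> (b *\<^sub>R z)\<bar> = norm (a *\<^sub>R z) * norm (b *\<^sub>R z)" for a b and z :: 'a
    by (simp add: abs_mult dot_square_norm power2_eq_square)
  ultimately have par: "parallel ?u ?v"
    unfolding parallel_def by (simp only: LIMSEQ_unique)
  show ?thesis
  \<comment> \<open>The limit was taken in the closed interval for compactness; its right end point
    is moved to 0 by periodicity, which preserves the derivative.\<close>
  proof (cases "l = 1")
    case True
    have "vector_derivative g (at 1) = vector_derivative g (at 0)"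
      using vector_derivative_at[OF has_vector_derivative_translate[where t = 0 and c = 1, OF generic_immersionD(3)[OF g]]] per
      by simp
    then show ?thesis using True gl par per[of 0] by (intro bexI[of _ 0]) auto
  next
    case False
    then show ?thesis using l gl par by (intro bexI[of _ l]) auto
  qed
qed

text \<open>The branches at a double point are transverse, so the direction \<open>v\<close> can
  belong to one of them only.\<close>

lemma parallel_lift_unique:
  assumes g: "generic_immersion M g" and "v \<noteq> 0"
    and "s \<in> {0..<1}" "t \<in> {0..<1}" and "g s = g t"
    and "parallel (vector_derivative g (at s)) v" "parallel (vector_derivative g (at t)) v"
  shows "s = t"
  using assms parallel_imp_span[of v "vector_derivative g (at s)" "vector_derivative g (at t)"]
    generic_immersionD(5)[OF g]
  by (intro generic_immersion_transverse[OF g]) (auto simp: parallel_commute)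

lemma double_times_reparam:
  assumes "bij_betw \<phi> {0..<1} {0..<1}" and "\<And>t. t \<in> {0..<1} \<Longrightarrow> g (\<phi> t) = g' t"
  shows "double_times g = \<phi> ` double_times g'"
proof (intro subset_antisym subsetI)
  have im: "\<phi> ` {0..<1} = {0..<1}" and inj: "inj_on \<phi> {0..<1}"
    using assms(1) by (auto simp: bij_betw_def)
  {
    fix s assume "s \<in> double_times g"
    then obtain r where "s \<in> \<phi> ` {0..<1}" "r \<in> \<phi> ` {0..<1}" "r \<noteq> s" "g r = g s"
      unfolding double_times_def im by auto
    then show "s \<in> \<phi> ` double_times g'" using assms(2) by (force simp: double_times_def)
  next
    fix s assume "s \<in> \<phi> ` double_times g'"
    then obtain t r where "t \<in> {0..<1}" "r \<in> {0..<1}" "r \<noteq> t" "g' r = g' t" "s = \<phi> t"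
      by (auto simp: double_times_def)
    moreover from this have "\<phi> t \<in> {0..<1}" "\<phi> r \<in> {0..<1}" "\<phi> r \<noteq> \<phi> t"
      using im inj by (auto simp: inj_on_eq_iff)
    ultimately show "s \<in> double_times g" using assms(2) unfolding double_times_def by force
  }
qed

text \<open>Here \<phi> sends \<open>t\<close> to the unique time of \<open>g\<close> with the same
  position and tangent line. Cutting both circles at a common simple point reduces the claim to a
  continuous injection on an open interval, which is monotone: increasing gives the same word,
  decreasing the reversed one.\<close>

lemma gauss_iso_word_of_pointed:
  fixes g g' :: "real \<Rightarrow> 'a::euclidean_space"
  assumes g: "generic_immersion M g" and g': "generic_immersion M' g'"
    and range: "range g = range g'" and base: "g 0 = g' 0" "0 \<notin> double_times g"
  shows "gauss_iso (word_of g') (word_of g)"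
proof -
  let ?D = "\<lambda>s. vector_derivative g (at s)" and ?D' = "\<lambda>t. vector_derivative g' (at t)"
  let ?R = "\<lambda>t s. g s = g' t \<and> parallel (?D s) (?D' t)"
  have "\<exists>s \<in> {0..<1}. ?R t s" for t
    using ex_parallel_lift[OF g g'] range by blast
  then obtain \<phi> where \<phi>: "\<And>t. \<phi> t \<in> {0..<1}" "\<And>t. ?R t (\<phi> t)" by metis
  have uniq: "s = \<phi> t" if "s \<in> {0..<1}" "?R t s" for s t
    using that \<phi>[of t] generic_immersionD(5)[OF g', of t]
    by (intro parallel_lift_unique[OF g, of "?D' t"]) auto
  have inj: "inj_on \<phi> {0..<1}"
  proof (rule inj_onI)
    fix t t' assume "t \<in> {0..<1}" "t' \<in> {0..<1}" "\<phi> t = \<phi> t'"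
    then show "t = t'"
      using \<phi>(2)[of t] \<phi>(2)[of t'] generic_immersionD(5)[OF g, of "\<phi> t"]
      by (intro parallel_lift_unique[OF g', of "?D (\<phi> t)"]) (auto simp: parallel_commute)
  qed
  have "s \<in> \<phi> ` {0..<1}" if "s \<in> {0..<1}" for s
  proof -
    obtain t where "t \<in> {0..<1}" "g' t = g s" "parallel (?D' t) (?D s)"
      using ex_parallel_lift[OF g' g, of s] range by blast
    then have "s = \<phi> t" by (intro uniq[OF that]) (simp add: parallel_commute)
    then show ?thesis using \<open>t \<in> {0..<1}\<close> by (rule image_eqI)
  qed
  then have "\<phi> ` {0..<1} = {0..<1}" using \<phi>(1) by auto
  with inj have bij: "bij_betw \<phi> {0..<1} {0..<1}" by (simp add: bij_betw_def)
  have dt: "double_times g = \<phi> ` double_times g'"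
    using double_times_reparam[OF bij] \<phi>(2) by blast
  \<comment> \<open>The base point is simple, so within the fundamental domain its position is
    attained at 0 alone.\<close>
  have \<phi>0: "\<phi> 0 = 0"
    using \<phi>[of 0] base by (force simp: double_times_def)
  then have base': "0 \<notin> double_times g'" using dt base(2) by force
  then have sub: "double_times g' \<subseteq> {0<..<1}" by (auto simp: double_times_def less_le)
  have graph: "(\<lambda>t. (t, \<phi> t)) ` {0<..<1} = {z \<in> {0<..<1} \<times> {0..1}.
      (g (snd z) - g' (fst z), \<bar>?D (snd z) \<bullet> ?D' (fst z)\<bar> - norm (?D (snd z)) * norm (?D' (fst z))) = (0, 0)}"
    (is "_ = ?G")
  proof (intro subset_antisym subsetI)
    fix z assume "z \<in> ?G"
    then obtain t s where z: "z = (t, s)" "t \<in> {0<..<1}" "s \<in> {0..1}" "?R t s"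
      by (auto simp: parallel_def)
    have "s \<noteq> 1"
    proof
      assume "s = 1"
      then have "g' t = g' 0" using z(4) generic_immersionD(2)[OF g, of 0] base(1) by simp
      then have "0 \<in> double_times g'"
        unfolding double_times_def using z(2) by (auto intro!: bexI[of _ t])
      then show False using base' by blast
    qed
    then have "s = \<phi> t" using uniq[of s t] z(3,4) by auto
    then show "z \<in> (\<lambda>t. (t, \<phi> t)) ` {0<..<1}" using z by auto
  next
    fix z assume "z \<in> (\<lambda>t. (t, \<phi> t)) ` {0<..<1}"
    then obtain t where t: "z = (t, \<phi> t)" "t \<in> {0<..<1}" by blast
    have "\<phi> t \<in> {0..1}" using \<phi>(1)[of t] by auto
    with t \<phi>(2)[of t] show "z \<in> ?G" by (simp add: parallel_def)
  qed
  have co: "continuous_on S (\<lambda>z. h (snd z))" "continuous_on S (\<lambda>z. h (fst z))"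
    if "continuous_on UNIV h" for h :: "real \<Rightarrow> 'a" and S :: "(real \<times> real) set"
    by (rule continuous_on_compose2[OF that]; auto intro: continuous_intros)+
  have "closedin (top_of_set ({0<..<1} \<times> {0..1})) ((\<lambda>t. (t, \<phi> t)) ` {0<..<1})"
    unfolding graph
    using generic_immersionD(4,7)[OF g] generic_immersionD(4,7)[OF g']
    by (intro continuous_closedin_preimage_constant continuous_intros co) auto
  then have "continuous_on {0<..<1} \<phi>"
    using \<phi>(1) by (subst continuous_closed_graph_eq[of "{0..1}"]) (auto simp: less_imp_le)
  moreover have "inj_on \<phi> {0<..<1}" using inj by (rule inj_on_subset) auto
  ultimately consider "strict_mono_on {0<..<1} \<phi>" | "strict_antimono_on {0<..<1} \<phi>"
    using injective_eq_monotone_map[of "{0<..<1}" \<phi>] by (auto simp: is_interval_oo)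
  then show ?thesis
  proof cases
    case 1
    then have "strict_mono_on (double_times g') \<phi>" using sub by (rule monotone_on_subset)
    then have "word_of g = word_of g'"
      unfolding word_of_def dt
      using generic_immersionD(6)[OF g'] \<phi>(2) by (simp add: sorted_list_of_set_strict_mono_image o_def)
    then show ?thesis by (simp add: gauss_iso_refl)
  next
    case 2
    then have "strict_antimono_on (double_times g') \<phi>" using sub by (rule monotone_on_subset)
    then have "word_of g = rev (word_of g')"
      unfolding word_of_def dt
      using generic_immersionD(6)[OF g'] \<phi>(2)
      by (simp add: sorted_list_of_set_strict_antimono_image rev_map o_def)
    then show ?thesis by (simp add: gauss_iso_rev)
  qed
qed

section \<open>Change of base point\<close>

lemma generic_immersion_shift:
  assumes g: "generic_immersion M g" and c: "c \<in> {0..<1}"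
  shows "generic_immersion M (\<lambda>t. g (t + c))" (is "generic_immersion M ?g")
    and "range (\<lambda>t. g (t + c)) = range g"
    and "gauss_iso (word_of g) (word_of (\<lambda>t. g (t + c)))"
    and "c \<notin> double_times g \<Longrightarrow> 0 \<notin> double_times (\<lambda>t. g (t + c))"
proof -
  note per = generic_immersionD(2)[OF g]
  \<comment> \<open>Translation by \<open>-c\<close> modulo 1 on the fundamental domain; \<tau> is
    its inverse.\<close>
  define \<sigma> where "\<sigma> t = (if c \<le> t then t - c else t + (1 - c))" for t
  define \<tau> where "\<tau> t = (if t + c < 1 then t + c else t + c - 1)" for t
  have bij: "bij_betw \<sigma> {0..<1} {0..<1}"
    by (rule bij_betw_byWitness[of _ \<tau>]) (use c in \<open>auto simp: \<sigma>_def \<tau>_def\<close>)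
  have bij': "bij_betw \<tau> {0..<1} {0..<1}"
    by (rule bij_betw_byWitness[of _ \<sigma>]) (use c in \<open>auto simp: \<sigma>_def \<tau>_def\<close>)
  have \<sigma>: "?g (\<sigma> t) = g t" for t using per[of t] by (simp add: \<sigma>_def)
  have \<tau>: "g (\<tau> t) = ?g t" for t using per[of "t + c - 1"] by (simp add: \<tau>_def)
  have dt: "double_times ?g = \<sigma> ` double_times g" and dt': "double_times g = \<tau> ` double_times ?g"
    using double_times_reparam[OF bij, of ?g g, OF \<sigma>] double_times_reparam[OF bij', of g ?g, OF \<tau>] by auto
  have D: "vector_derivative ?g (at t) = vector_derivative g (at (t + c))" for t
    by (rule vector_derivative_at[OF has_vector_derivative_translate[OF generic_immersionD(3)[OF g]]])
  show ra: "range ?g = range g"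
  proof -
    have "g t \<in> range ?g" for t using rangeI[of ?g "t - c"] by simp
    then show ?thesis by auto
  qed
  have fin: "finite (double_times g)" by (rule generic_immersionD(6)[OF g])
  have "?g C1_differentiable_on UNIV"
    unfolding C1_differentiable_on_def
  proof (intro exI conjI ballI)
    show "(?g has_vector_derivative vector_derivative g (at (t + c))) (at t)" for t
      by (rule has_vector_derivative_translate[OF generic_immersionD(3)[OF g]])
    show "continuous_on UNIV (\<lambda>t. vector_derivative g (at (t + c)))"
      by (rule continuous_on_compose2[OF generic_immersionD(4)[OF g]]) (simp_all add: continuous_on_add)
  qed
  moreover have "r = s \<or> s = t \<or> r = t"
    if "r \<in> {0..<1}" "s \<in> {0..<1}" "t \<in> {0..<1}" "?g r = ?g s" "?g s = ?g t" for r s t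
  proof -
    have "\<tau> r = \<tau> s \<or> \<tau> s = \<tau> t \<or> \<tau> r = \<tau> t"
      using that bij_betwE[OF bij'] \<tau> by (intro generic_immersion_triple[OF g]) auto
    then show ?thesis using that bij' by (auto simp: bij_betw_def inj_on_eq_iff)
  qed
  moreover have "vector_derivative ?g (at s) \<notin> span {vector_derivative ?g (at t)}"
    if "s \<in> {0..<1}" "t \<in> {0..<1}" "s \<noteq> t" "?g s = ?g t" for s t
  proof -
    have "vector_derivative g (at (\<tau> r)) = vector_derivative g (at (r + c))" for r
      using vector_derivative_at[OF has_vector_derivative_translate[where t = "r + c - 1" and c = 1, OF generic_immersionD(3)[OF g]]] per
      by (simp add: \<tau>_def)
    moreover have "\<tau> s \<noteq> \<tau> t" using that bij' by (auto simp: bij_betw_def inj_on_eq_iff)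
    ultimately show ?thesis
      using that bij_betwE[OF bij'] generic_immersion_transverse[OF g, of "\<tau> s" "\<tau> t"] \<tau> D by auto
  qed
  ultimately show "generic_immersion M ?g"
    unfolding generic_immersion_def
    using generic_immersionD(1,5)[OF g] ra per fin by (simp add: D dt add.assoc add.commute[of 1]) (simp add: add.assoc[symmetric])
  let ?A = "double_times g \<inter> {..<c}" and ?B = "double_times g \<inter> {c..}"
  have AB: "double_times g = ?A \<union> ?B" by auto
  have s1: "sorted_list_of_set (double_times g) = sorted_list_of_set ?A @ sorted_list_of_set ?B"
    by (subst AB, rule sorted_list_of_set_append) (use fin in auto)
  \<comment> \<open>Times from \<open>c\<close> on now come first, and earlier ones follow one
    period later. As \<sigma> is increasing on each part, the word is cut at \<open>c\<close> and
    its two pieces change places.\<close>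
  have "sorted_list_of_set (double_times ?g) = sorted_list_of_set (\<sigma> ` ?B) @ sorted_list_of_set (\<sigma> ` ?A)"
    unfolding dt by (subst AB, subst image_Un, subst Un_commute, rule sorted_list_of_set_append)
      (use fin in \<open>auto simp: \<sigma>_def double_times_def\<close>)
  moreover have "strict_mono_on ?A \<sigma>" "strict_mono_on ?B \<sigma>" by (auto simp: \<sigma>_def monotone_on_def)
  ultimately have s2: "sorted_list_of_set (double_times ?g) =
      map \<sigma> (sorted_list_of_set ?B) @ map \<sigma> (sorted_list_of_set ?A)"
    using fin by (simp add: sorted_list_of_set_strict_mono_image)
  have "word_of ?g = map g (sorted_list_of_set ?B) @ map g (sorted_list_of_set ?A)"
    using \<sigma> by (simp add: word_of_def s2 o_def)
  then show "gauss_iso (word_of g) (word_of ?g)"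
    by (simp add: word_of_def s1 gauss_iso_append_commute)
  assume "c \<notin> double_times g"
  then show "0 \<notin> double_times ?g" using dt' c by (force simp: \<tau>_def)
qed

text \<open>Since double times are finite in number, some point is simple. Both circles can be cut
  there, and moving the base points only rotates the words.\<close>

lemma gauss_iso_word_of:
  fixes g g' :: "real \<Rightarrow> 'a::euclidean_space"
  assumes g: "generic_immersion M g" and g': "generic_immersion M' g'"
    and range: "range g = range g'"
  shows "gauss_iso (word_of g) (word_of g')"
proof -
  have "infinite {0..<1::real}" by (simp add: infinite_Ico)
  then obtain c where c: "c \<in> {0..<1}" "c \<notin> double_times g"
    using generic_immersionD(6)[OF g] by (meson finite_subset subsetI)
  obtain c' where c': "c' \<in> {0..<1}" "g' c' = g c"
    using ex_parallel_lift[OF g' g, of c] range by blast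
  note s = generic_immersion_shift[OF g c(1)] and s' = generic_immersion_shift[OF g' c'(1)]
  have "gauss_iso (word_of (\<lambda>t. g' (t + c'))) (word_of (\<lambda>t. g (t + c)))"
    using s(2,4) s'(2) c c' range by (intro gauss_iso_word_of_pointed[OF s(1) s'(1)]) auto
  then show ?thesis
    using gauss_iso_trans[OF s(3) gauss_iso_trans[OF gauss_iso_sym gauss_iso_sym[OF s'(3)]]] by blast
qed

text \<open>Makes the arbitrary choice in \<open>CD\<close> harmless: any parametrization of the
  curve computes its diagram.\<close>

lemma CD_range:
  assumes "generic_immersion M g"
  shows "CD M (range g) = diagram (word_of g)"
proof -
  let ?g = "SOME g'. generic_immersion M g' \<and> range g' = range g"
  have "generic_immersion M ?g \<and> range ?g = range g"
    using assms by (intro someI[of "\<lambda>g'. generic_immersion M g' \<and> range g' = range g" g]) simp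
  then show ?thesis
    unfolding CD_def using gauss_iso_word_of assms by (intro diagram_cong) blast
qed

section \<open>Diffeomorphisms and ambient isotopy\<close>

lemma generic_immersion_diffeomorphism:
  assumes g: "generic_immersion M g" and h: "diffeomorphism M h"
  shows "generic_immersion M (h \<circ> g)" and "word_of (h \<circ> g) = map h (word_of g)"
    and "inj_on h M"
proof -
  obtain k where k: "C1_near M k" and hom: "homeomorphism M M h k" and h1: "C1_near M h"
    using h unfolding diffeomorphism_def by blast
  obtain U h' where h': "M \<subseteq> U" "continuous_on U h'"
    "\<And>x. x \<in> U \<Longrightarrow> (h has_derivative blinfun_apply (h' x)) (at x)"
    using h1 unfolding C1_near_def by blast
  obtain V k' where k': "M \<subseteq> V" "\<And>x. x \<in> V \<Longrightarrow> (k has_derivative blinfun_apply (k' x)) (at x)"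
    using k unfolding C1_near_def by blast
  have gM: "g t \<in> M" for t using generic_immersionD(1)[OF g] by auto
  show inj: "inj_on h M" using hom by (metis homeomorphism_apply1 inj_onI)
  then have eq: "h (g s) = h (g t) \<longleftrightarrow> g s = g t" for s t using gM by (auto simp: inj_on_eq_iff)
  have dt: "double_times (h \<circ> g) = double_times g" by (simp add: double_times_def eq)
  show "word_of (h \<circ> g) = map h (word_of g)" by (simp add: word_of_def dt)
  define W where "W t = h' (g t) (vector_derivative g (at t))" for t
  have hd: "((h \<circ> g) has_vector_derivative W t) (at t)" for t
  proof -
    have "((h \<circ> g) has_derivative (h' (g t) \<circ> (\<lambda>x. x *\<^sub>R vector_derivative g (at t)))) (at t)"
      using generic_immersionD(3)[OF g, of t] h'(1,3) gM[of t]
      by (intro diff_chain_at) (auto simp: has_vector_derivative_def)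
    then show ?thesis by (simp add: has_vector_derivative_def W_def o_def blinfun.scaleR_right)
  qed
  then have W: "vector_derivative (h \<circ> g) (at t) = W t" for t by (rule vector_derivative_at)
  \<comment> \<open>The chain rule for \<open>k \<circ> (h \<circ> g) = g\<close>: the derivative of
    \<open>k\<close> undoes that of \<open>h\<close> on velocities, which carries nonvanishing and
    transversality over to \<open>h \<circ> g\<close>.\<close>
  have kW: "k' (h (g t)) (W t) = vector_derivative g (at t)" for t
  proof -
    have "h (g t) \<in> V" using gM hom k'(1) by (metis homeomorphism_image1 imageI subsetD)
    then have "((k \<circ> (h \<circ> g)) has_derivative (k' (h (g t)) \<circ> (\<lambda>x. x *\<^sub>R W t))) (at t)"
      using hd[of t] k'(2) by (intro diff_chain_at) (auto simp: has_vector_derivative_def)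
    moreover have "k \<circ> (h \<circ> g) = g" using hom gM by (auto simp: homeomorphism_apply1)
    ultimately have "(g has_vector_derivative k' (h (g t)) (W t)) (at t)"
      by (simp add: has_vector_derivative_def o_def blinfun.scaleR_right)
    then show ?thesis by (rule vector_derivative_at[symmetric])
  qed
  have "continuous_on UNIV W"
    unfolding W_def using h'(1) gM generic_immersionD(4,7)[OF g]
    by (intro continuous_intros continuous_on_compose2[OF h'(2)]) auto
  then have "(h \<circ> g) C1_differentiable_on UNIV"
    unfolding C1_differentiable_on_def using hd by blast
  moreover have "W t \<noteq> 0" for t using kW[of t] generic_immersionD(5)[OF g, of t] by auto
  moreover have "W s \<notin> span {W t}" if "s \<in> {0..<1}" "t \<in> {0..<1}" "s \<noteq> t" "g s = g t" for s t
  proof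
    assume "W s \<in> span {W t}"
    then obtain c where "W s = c *\<^sub>R W t" by (auto simp: span_singleton)
    then have "vector_derivative g (at s) = c *\<^sub>R vector_derivative g (at t)"
      using kW[of s] kW[of t] that(4) by (simp add: blinfun.scaleR_right)
    then show False
      using generic_immersion_transverse[OF g that(1,2,4)] that(3) by (simp add: span_base span_scale)
  qed
  moreover have "range (h \<circ> g) \<subseteq> M" using gM hom by (auto simp: homeomorphism_def)
  ultimately show "generic_immersion M (h \<circ> g)"
    unfolding generic_immersion_def W dt
    using generic_immersionD(2,6)[OF g] generic_immersion_triple[OF g] eq by simp
qed

lemma CD_ambient_isotopic:
  assumes "curve M P" and "ambient_isotopic M P Q"
  shows "CD M P = CD M Q"
proof -
  obtain g where g: "generic_immersion M g" "range g = P" using assms(1) unfolding curve_def by blast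
  obtain H :: "real \<Rightarrow> 'a \<Rightarrow> 'a" where H: "diffeomorphism M (H 1)" "H 1 ` P = Q"
    using assms(2) unfolding ambient_isotopic_def by force
  note d = generic_immersion_diffeomorphism[OF g(1) H(1)]
  have "inj_on (H 1) (set (word_of g))"
    using d(3) generic_immersionD(1)[OF g(1)] by (rule_tac inj_on_subset) (auto simp: word_of_def generic_immersionD(6)[OF g(1)])
  then have "diagram (word_of g) = diagram (word_of (H 1 \<circ> g))"
    unfolding d(2) by (intro diagram_cong gauss_iso_map)
  moreover have "range (H 1 \<circ> g) = Q" using g(2) H(2) by (simp only: image_comp[symmetric])
  ultimately show ?thesis using CD_range[OF g(1)] CD_range[OF d(1)] g(2) by simp
qed

section \<open>Passages through a disc\<close>

lemma sorted_list_of_set_split: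
  fixes D :: "'a::linorder set"
  assumes "finite D" and "a \<le> b"
  shows "sorted_list_of_set D =
    sorted_list_of_set (D \<inter> {..<a}) @ sorted_list_of_set (D \<inter> {a..b}) @ sorted_list_of_set (D \<inter> {b<..})"
proof -
  have "D = D \<inter> {..<a} \<union> (D \<inter> {a..b} \<union> D \<inter> {b<..})" using assms(2) by auto
  then have "sorted_list_of_set D = sorted_list_of_set (D \<inter> {..<a} \<union> (D \<inter> {a..b} \<union> D \<inter> {b<..}))"
    by simp
  also have "\<dots> = sorted_list_of_set (D \<inter> {..<a}) @ sorted_list_of_set (D \<inter> {a..b} \<union> D \<inter> {b<..})"
    using assms by (intro sorted_list_of_set_append) auto
  also have "sorted_list_of_set (D \<inter> {a..b} \<union> D \<inter> {b<..}) =
      sorted_list_of_set (D \<inter> {a..b}) @ sorted_list_of_set (D \<inter> {b<..})"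
    using assms by (intro sorted_list_of_set_append) auto
  finally show ?thesis .
qed

text \<open>The analogue of \<open>double_times\<close> for a family of arcs. Equal parameters are
  excluded on a single arc only: two arcs may well meet at equal parameters, as the straight arcs of
  RIII do in the origin.\<close>

definition crossing_params :: "nat \<Rightarrow> (nat \<Rightarrow> real \<Rightarrow> 'b) \<Rightarrow> nat \<Rightarrow> real set" where
  "crossing_params n A k =
     {t \<in> {-1..1}. \<exists>l<n. \<exists>s \<in> {-1..1}. (l = k \<longrightarrow> s \<noteq> t) \<and> A l s = A k t}"

text \<open>One side of a move, with \<open>h\<close> as chart of the disc. The two sides
  instantiate it with the same time intervals and signs.\<close>

locale passage =
  fixes M :: "'a::euclidean_space set" and g :: "real \<Rightarrow> 'a" and h :: "real \<times> real \<Rightarrow> 'a"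
    and A :: "nat \<Rightarrow> real \<Rightarrow> real \<times> real" and n :: nat and a b e :: "nat \<Rightarrow> real"
  assumes g: "generic_immersion M g"
    and inj_h: "inj_on h square"
    and bounds: "k < n \<Longrightarrow> 0 < a k \<and> a k < b k \<and> b k < 1"
    and sign: "k < n \<Longrightarrow> e k \<in> {1, -1}"
    and disj: "disjoint_family_on (\<lambda>k. {a k..b k}) {..<n}"
    and trav: "k < n \<Longrightarrow> traverses g (a k) (b k) (h \<circ> A k) (e k)"
    and in_square: "k < n \<Longrightarrow> t \<in> {-1..1} \<Longrightarrow> A k t \<in> square"
    and outside: "t \<in> {0..1} - (\<Union>k<n. {a k..b k}) \<Longrightarrow> g t \<notin> h ` square"
begin

definition inner :: "real set" where
  "inner = (\<Union>k<n. {a k..b k})"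

lemma finite_double_times: "finite (double_times g)"
  by (rule generic_immersionD(6)[OF g])

text \<open>The sign is absorbed into \<tau>, which is \<rho> or its negative, and survives only as
  the direction of monotonicity.\<close>

lemma ex_param:
  assumes "k < n"
  shows "\<exists>\<tau>. bij_betw \<tau> {a k..b k} {-1..1} \<and> (\<forall>t \<in> {a k..b k}. g t = h (A k (\<tau> t))) \<and>
     (if e k = 1 then strict_mono_on {a k..b k} \<tau> else strict_antimono_on {a k..b k} \<tau>)"
proof -
  obtain \<rho> where \<rho>: "continuous_on {a k..b k} \<rho>" "strict_mono_on {a k..b k} \<rho>" "\<rho> (a k) = -1" "\<rho> (b k) = 1"
    "\<forall>t \<in> {a k..b k}. g t = (h \<circ> A k) (e k * \<rho> t)"
    using trav[OF assms] unfolding traverses_def by blast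
  have ab: "a k < b k" using bounds[OF assms] by blast
  have "\<rho> ` {a k..b k} = {-1..1}"
  proof (intro subset_antisym subsetI)
    fix y :: real assume "y \<in> {-1..1}"
    then show "y \<in> \<rho> ` {a k..b k}"
      using IVT'[of \<rho> "a k" y "b k"] \<rho>(1,3,4) ab by force
  next
    fix y assume "y \<in> \<rho> ` {a k..b k}"
    then obtain t where t: "t \<in> {a k..b k}" "y = \<rho> t" by blast
    have "\<rho> (a k) \<le> \<rho> t" "\<rho> t \<le> \<rho> (b k)"
      using t(1) ab by (auto intro!: monotone_onD[OF strict_mono_on_imp_mono_on[OF \<rho>(2)]])
    then show "y \<in> {-1..1}" using t(2) \<rho>(3,4) by simp
  qed
  then have bij: "bij_betw \<rho> {a k..b k} {-1..1}"
    using strict_mono_on_imp_inj_on[OF \<rho>(2)] by (simp add: bij_betw_def)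
  show ?thesis
  proof (cases "e k = 1")
    case True
    then show ?thesis using bij \<rho>(2,5) by (intro exI[of _ \<rho>]) simp
  next
    case False
    then have e: "e k = -1" using sign[OF assms] by auto
    have "bij_betw uminus {-1..1} {-1..1::real}"
      by (rule bij_betw_byWitness[of _ uminus]) auto
    from bij_betw_trans[OF bij this] have "bij_betw (\<lambda>t. - \<rho> t) {a k..b k} {-1..1}"
      by (simp add: o_def)
    moreover have "strict_antimono_on {a k..b k} (\<lambda>t. - \<rho> t)"
      using \<rho>(2) by (simp add: monotone_on_def)
    ultimately show ?thesis using e \<rho>(5) by (intro exI[of _ "\<lambda>t. - \<rho> t"]) simp
  qed
qed

lemma same_interval:
  "k < n \<Longrightarrow> l < n \<Longrightarrow> t \<in> {a k..b k} \<Longrightarrow> t \<in> {a l..b l} \<Longrightarrow> k = l"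
  using disj unfolding disjoint_family_on_def by blast

lemma interval_subset: "k < n \<Longrightarrow> {a k..b k} \<subseteq> {0<..<1}"
  using bounds[of k] by auto

text \<open>Injectivity of \<open>h\<close> turns coincidences of \<open>g\<close> in the disc into
  coincidences of model arcs. No partner is lost, as \<open>g\<close> stays out of the disc at all
  other times. A negative sign reads the crossings backwards.\<close>

lemma inside_word:
  assumes k: "k < n"
  shows "map g (sorted_list_of_set (double_times g \<inter> {a k..b k})) =
    map h ((if e k = 1 then id else rev) (map (A k) (sorted_list_of_set (crossing_params n A k))))"
proof -
  have "\<exists>\<tau>. \<forall>l<n. bij_betw (\<tau> l) {a l..b l} {-1..1} \<and> (\<forall>t \<in> {a l..b l}. g t = h (A l (\<tau> l t))) \<and>
     (if e l = 1 then strict_mono_on {a l..b l} (\<tau> l) else strict_antimono_on {a l..b l} (\<tau> l))"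
    using ex_param by metis
  then obtain \<tau> where \<tau>: "\<And>l. l < n \<Longrightarrow> bij_betw (\<tau> l) {a l..b l} {-1..1}"
    "\<And>l t. l < n \<Longrightarrow> t \<in> {a l..b l} \<Longrightarrow> g t = h (A l (\<tau> l t))"
    "\<And>l. l < n \<Longrightarrow> if e l = 1 then strict_mono_on {a l..b l} (\<tau> l) else strict_antimono_on {a l..b l} (\<tau> l)"
    by metis
  have im: "\<tau> l ` {a l..b l} = {-1..1}" if "l < n" for l using \<tau>(1)[OF that] by (simp add: bij_betw_def)
  have img: "\<tau> l t \<in> {-1..1}" if "l < n" "t \<in> {a l..b l}" for l t using im that by blast
  have eq_iff: "g s = g t \<longleftrightarrow> A l (\<tau> l s) = A m (\<tau> m t)"
    if "l < n" "m < n" "s \<in> {a l..b l}" "t \<in> {a m..b m}" for l m s t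
    using that \<tau>(2)[OF that(1,3)] \<tau>(2)[OF that(2,4)] inj_on_eq_iff[OF inj_h in_square in_square]
      img[OF that(1,3)] img[OF that(2,4)] by simp
  let ?D = "double_times g \<inter> {a k..b k}"
  have "crossing_params n A k = \<tau> k ` ?D"
  proof (intro subset_antisym subsetI)
    fix y assume "y \<in> crossing_params n A k"
    then obtain l z where lz: "y \<in> {-1..1}" "l < n" "z \<in> {-1..1}" "l = k \<longrightarrow> z \<noteq> y" "A l z = A k y"
      unfolding crossing_params_def by blast
    obtain t where t: "t \<in> {a k..b k}" "y = \<tau> k t" using im[OF k] lz(1) by blast
    obtain s where s: "s \<in> {a l..b l}" "z = \<tau> l s" using im[OF lz(2)] lz(3) by blast
    have "g s = g t" using eq_iff[OF lz(2) k s(1) t(1)] lz(5) s(2) t(2) by simp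
    moreover have "s \<noteq> t" using same_interval[OF k lz(2)] s t lz(4) by blast
    moreover have "s \<in> {0..<1}" "t \<in> {0..<1}" using interval_subset[OF k] interval_subset[OF lz(2)] s t by auto
    ultimately have "t \<in> ?D" using t unfolding double_times_def by blast
    then show "y \<in> \<tau> k ` ?D" using t(2) by blast
  next
    fix y assume "y \<in> \<tau> k ` ?D"
    then obtain t s where t: "y = \<tau> k t" "t \<in> {a k..b k}" "s \<in> {0..<1}" "s \<noteq> t" "g s = g t"
      unfolding double_times_def by blast
    have "g s \<in> h ` square"
      using \<tau>(2)[OF k t(2)] in_square[OF k img[OF k t(2)]] t(5) by auto
    then have "s \<in> (\<Union>k<n. {a k..b k})" using outside[of s] t(3) by force
    then obtain l where l: "l < n" "s \<in> {a l..b l}" by blast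
    have "A l (\<tau> l s) = A k (\<tau> k t)" using eq_iff[OF l(1) k l(2) t(2)] t(5) by blast
    moreover have "l = k \<longrightarrow> \<tau> l s \<noteq> \<tau> k t"
      using l t(2,4) \<tau>(1)[OF k] by (auto simp: bij_betw_def inj_on_eq_iff)
    ultimately show "y \<in> crossing_params n A k"
      unfolding crossing_params_def using l t(1) img[OF k t(2)] img[OF l] by blast
  qed
  moreover have "map g (sorted_list_of_set ?D) = map (\<lambda>t. h (A k (\<tau> k t))) (sorted_list_of_set ?D)"
    using \<tau>(2)[OF k] finite_double_times by simp
  moreover have "if e k = 1 then strict_mono_on ?D (\<tau> k) else strict_antimono_on ?D (\<tau> k)"
    using \<tau>(3)[OF k] by (auto intro: monotone_on_subset split: if_splits)
  ultimately show ?thesis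
    using finite_double_times
    by (simp add: sorted_list_of_set_strict_mono_image sorted_list_of_set_strict_antimono_image rev_map o_def
        split: if_splits)
qed

lemma inside_letter:
  assumes "t \<in> inner"
  shows "g t \<in> h ` square"
proof -
  obtain k where k: "k < n" "t \<in> {a k..b k}" using assms by (auto simp: inner_def)
  obtain \<tau> where "bij_betw \<tau> {a k..b k} {-1..1}" "g t = h (A k (\<tau> t))"
    using ex_param[OF k(1)] k(2) by blast
  then show ?thesis using in_square[OF k(1)] bij_betwE k(2) by blast
qed

text \<open>An outer time shares its position with outer times only, so the outer double times
  depend just on values of \<open>g\<close> at outer times, where both sides of a move
  agree.\<close>

lemma outer_double_times:
  "double_times g - inner = {t \<in> {0..<1} - inner. \<exists>s \<in> {0..<1} - inner. s \<noteq> t \<and> g s = g t}"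
proof -
  have "s \<notin> inner" if "t \<in> {0..<1}" "t \<notin> inner" "g s = g t" for s t
    using inside_letter[of s] outside[of t] that by (auto simp: inner_def)
  then show ?thesis unfolding double_times_def by blast
qed

definition gap :: "real set \<Rightarrow> 'a list" where
  "gap J = map g (sorted_list_of_set ((double_times g - inner) \<inter> J))"

lemma set_gap: "set (gap J) \<inter> h ` square = {}"
proof -
  have "g t \<notin> h ` square" if "t \<in> double_times g - inner" for t
    using outside[of t] that by (simp add: inner_def double_times_def)
  then show ?thesis using finite_double_times by (auto simp: gap_def)
qed

lemma gap_eq:
  assumes "J \<inter> inner = {}"
  shows "map g (sorted_list_of_set (double_times g \<inter> J)) = gap J"
proof -
  have "double_times g \<inter> J = (double_times g - inner) \<inter> J" using assms by blast
  then show ?thesis by (simp add: gap_def)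
qed

definition inside :: "nat \<Rightarrow> 'a list" where
  "inside k = map g (sorted_list_of_set (double_times g \<inter> {a k..b k}))"

lemma set_inside: "k < n \<Longrightarrow> set (inside k) \<subseteq> h ` square"
  using inside_letter finite_double_times by (force simp: inside_def inner_def)

lemma intervals_ordered:
  assumes "k < n" and "l < n" and "k \<noteq> l"
  shows "b k < a l \<or> b l < a k"
proof (rule ccontr)
  assume "\<not> ?thesis"
  then have "max (a k) (a l) \<in> {a k..b k} \<inter> {a l..b l}" using bounds[OF assms(1)] bounds[OF assms(2)] by auto
  then show False using same_interval[OF assms(1,2)] assms(3) by blast
qed

lemma word_of_1:
  assumes n: "n = 1"
  shows "word_of g = gap {..<a 0} @ inside 0 @ gap {b 0<..}"
proof -
  have "a 0 \<le> b 0" using bounds[of 0] n by simp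
  from sorted_list_of_set_split[OF finite_double_times this]
  have "word_of g = map g (sorted_list_of_set (double_times g \<inter> {..<a 0})) @ inside 0 @
      map g (sorted_list_of_set (double_times g \<inter> {b 0<..}))"
    by (simp add: word_of_def inside_def)
  moreover have "{..<a 0} \<inter> inner = {}" "{b 0<..} \<inter> inner = {}"
    using n unfolding inner_def by (auto simp: less_Suc_eq)
  ultimately show ?thesis by (simp add: gap_eq)
qed

text \<open>\<open>k\<close> and \<open>l\<close> are the arcs in the order of time, which the base
  point decides; the equation for \<open>{..<n}\<close> admits both orders.\<close>

lemma word_of_2:
  assumes n: "n = 2" and k: "{..<n} = {k, l}" and "b k < a l"
  shows "word_of g = gap {..<a k} @ inside k @ gap {b k<..<a l} @ inside l @ gap {b l<..}"
proof -
  have kl: "k < n" "l < n" using k by blast+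
  have le: "a k < b k" "a l < b l" using bounds[OF kl(1)] bounds[OF kl(2)] by auto
  have "sorted_list_of_set (double_times g) = sorted_list_of_set (double_times g \<inter> {..<a k}) @
      sorted_list_of_set (double_times g \<inter> {a k..b k}) @ sorted_list_of_set (double_times g \<inter> {b k<..<a l}) @
      sorted_list_of_set (double_times g \<inter> {a l..b l}) @ sorted_list_of_set (double_times g \<inter> {b l<..})"
  proof -
    have "{b k<..} \<inter> {..<a l} = {b k<..<a l}" "{b k<..} \<inter> {a l..b l} = {a l..b l}" "{b k<..} \<inter> {b l<..} = {b l<..}"
      using assms(3) le by auto
    then show ?thesis
      using sorted_list_of_set_split[OF finite_double_times less_imp_le[OF le(1)]]
        sorted_list_of_set_split[of "double_times g \<inter> {b k<..}" "a l" "b l"] finite_double_times le(2)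
      by (simp add: Int_assoc)
  qed
  moreover have "{..<a k} \<inter> inner = {}" "{b k<..<a l} \<inter> inner = {}" "{b l<..} \<inter> inner = {}"
    unfolding inner_def k using assms(3) le by auto
  ultimately show ?thesis
    by (simp add: word_of_def inside_def gap_eq)
qed

lemma word_of_3:
  assumes n: "n = 3" and k: "{..<n} = {k, l, m}" and "b k < a l" and "b l < a m"
  shows "word_of g = gap {..<a k} @ inside k @ gap {b k<..<a l} @ inside l @ gap {b l<..<a m} @ inside m @ gap {b m<..}"
proof -
  have kl: "k < n" "l < n" "m < n" using k by blast+
  have le: "a k < b k" "a l < b l" "a m < b m" using bounds[OF kl(1)] bounds[OF kl(2)] bounds[OF kl(3)] by auto
  have "sorted_list_of_set (double_times g) = sorted_list_of_set (double_times g \<inter> {..<a k}) @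
      sorted_list_of_set (double_times g \<inter> {a k..b k}) @ sorted_list_of_set (double_times g \<inter> {b k<..<a l}) @
      sorted_list_of_set (double_times g \<inter> {a l..b l}) @ sorted_list_of_set (double_times g \<inter> {b l<..<a m}) @
      sorted_list_of_set (double_times g \<inter> {a m..b m}) @ sorted_list_of_set (double_times g \<inter> {b m<..})"
  proof -
    have "{b k<..} \<inter> {..<a l} = {b k<..<a l}" "{b k<..} \<inter> {a l..b l} = {a l..b l}" "{b k<..} \<inter> {b l<..} = {b l<..}"
      "{b l<..} \<inter> {..<a m} = {b l<..<a m}" "{b l<..} \<inter> {a m..b m} = {a m..b m}" "{b l<..} \<inter> {b m<..} = {b m<..}"
      using assms(3,4) le by auto
    then show ?thesis
      using sorted_list_of_set_split[OF finite_double_times less_imp_le[OF le(1)]]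
        sorted_list_of_set_split[of "double_times g \<inter> {b k<..}" "a l" "b l"]
        sorted_list_of_set_split[of "double_times g \<inter> {b l<..}" "a m" "b m"] finite_double_times le
      by (simp add: Int_assoc)
  qed
  moreover have "{..<a k} \<inter> inner = {}" "{b k<..<a l} \<inter> inner = {}" "{b l<..<a m} \<inter> inner = {}" "{b m<..} \<inter> inner = {}"
    unfolding inner_def k using assms(3,4) le by auto
  ultimately show ?thesis
    by (simp add: word_of_def inside_def gap_eq)
qed

end

section \<open>Crossings of the model arcs\<close>

text \<open>In every model, the parameters of the two passages through a crossing are opposite.\<close>

lemma crossing_params_eqI:
  fixes A :: "nat \<Rightarrow> real \<Rightarrow> 'b"
  assumes "\<forall>t \<in> X. t \<in> {-1..1} \<and> (\<exists>l \<in> set [0..<n]. (l = k \<longrightarrow> t \<noteq> 0) \<and> A l (- t) = A k t)"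
    and "\<And>l s t. l < n \<Longrightarrow> s \<in> {-1..1} \<Longrightarrow> t \<in> {-1..1} \<Longrightarrow> A l s = A k t \<Longrightarrow> (l = k \<longrightarrow> s \<noteq> t) \<Longrightarrow> t \<in> X"
  shows "crossing_params n A k = X"
proof (intro subset_antisym subsetI)
  fix t assume t: "t \<in> X"
  then obtain l where l: "l < n" "l = k \<longrightarrow> - t \<noteq> t" "A l (- t) = A k t" using assms(1) by fastforce
  have t': "t \<in> {-1..1}" using assms(1) t by blast
  then have "- t \<in> {-1..1}" by simp
  then show "t \<in> crossing_params n A k"
    unfolding crossing_params_def mem_Collect_eq
    using l t' by (intro conjI exI[of _ l] bexI[of _ "- t"]) simp_all
next
  fix t assume "t \<in> crossing_params n A k"
  then obtain l s where "t \<in> {-1..1}" "l < n" "s \<in> {-1..1}" "l = k \<longrightarrow> s \<noteq> t" "A l s = A k t"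
    unfolding crossing_params_def mem_Collect_eq by (elim conjE exE bexE)
  then show "t \<in> X" by (intro assms(2))
qed

lemma less_3_cases: "k < 3 \<Longrightarrow> (k = 0 \<Longrightarrow> P) \<Longrightarrow> (k = 1 \<Longrightarrow> P) \<Longrightarrow> (k = 2 \<Longrightarrow> P) \<Longrightarrow> P" for k :: nat
  by force

lemma all_arcs_in_square:
  assumes "t \<in> {-1..1}"
  shows "\<forall>A \<in> set (arcs m) \<union> set (arcs' m). A t \<in> square"
proof -
  have t: "-1 \<le> t" "t \<le> 1" using assms by auto
  have t2: "t\<^sup>2 \<le> 1" using t by (simp add: abs_square_le_1 abs_le_iff)
  have t2': "-1 \<le> t\<^sup>2 - 1/2" "-1 \<le> t\<^sup>2 - 1/4" "- t\<^sup>2 \<le> 2" using zero_le_power2[of t] by linarith+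
  \<comment> \<open>The first product equals \<open>3 - (4 * t ^ 3 - t)\<close>, the second
    \<open>3 + (4 * t ^ 3 - t)\<close>; they bound the first coordinate of the kink.\<close>
  have "0 \<le> (1 - t) * ((2 * t + 1)\<^sup>2 + 2)" "0 \<le> (1 + t) * ((2 * t - 1)\<^sup>2 + 2)"
    using t by (auto intro!: mult_nonneg_nonneg)
  then have t3: "4 * t ^ 3 - t \<le> 3" "-3 \<le> 4 * t ^ 3 - t"
    by (simp_all add: power2_eq_square power3_eq_cube algebra_simps)
  have mem: "(x, y) \<in> square \<longleftrightarrow> -1 \<le> x \<and> x \<le> 1 \<and> -1 \<le> y \<and> y \<le> 1" for x y :: real
    by (auto simp: cbox_Pair_eq)
  show ?thesis
    using t t2 t2' t3
    by (cases m) (simp_all add: mem arcs_RII_def arcs_RII'_def arcs_RIII_def arcs_RIII'_def)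
qed

lemma length_arcs' [simp]: "length (arcs' m) = length (arcs m)"
  by (cases m) (simp_all add: arcs_RII_def arcs_RII'_def arcs_RIII_def arcs_RIII'_def)

lemma square_eq_quarter: "t\<^sup>2 = 1/4 \<longleftrightarrow> t = 1/2 \<or> t = -1/2" for t :: real
proof -
  have "t\<^sup>2 - 1/4 = (t - 1/2) * (t + 1/2)" by (simp add: power2_eq_square algebra_simps)
  then have "t\<^sup>2 = 1/4 \<longleftrightarrow> t - 1/2 = 0 \<or> t + 1/2 = 0"
    using mult_eq_0_iff[of "t - 1/2" "t + 1/2"] by linarith
  then show ?thesis by linarith
qed

text \<open>The quadratic factors as \<open>(1 - 2 * t) * (t + 2)\<close>, and the root -2 lies
  outside the model interval.\<close>

lemma parabola_meets_line:
  fixes t :: real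
  assumes "t \<in> {-1..1}" and "2 * (1 - t\<^sup>2) = 3 * t"
  shows "t = 1/2"
proof -
  have "(1 - 2 * t) * (t + 2) = 0" using assms(2) by (simp add: power2_eq_square algebra_simps)
  moreover have "t + 2 \<noteq> 0" using assms(1) by auto
  ultimately show ?thesis by auto
qed

lemma sorted_list_of_set_doubleton: "s < t \<Longrightarrow> sorted_list_of_set {s, t} = [s, t]" for s t :: real
  by (rule sorted_list_of_set_eqI) auto

lemma crossings_RI:
  "map (arcs RI ! 0) (sorted_list_of_set (crossing_params 1 ((!) (arcs RI)) 0)) = [(0, -1/4), (0, -1/4)]"
proof -
  have "crossing_params 1 ((!) (arcs RI)) 0 = {-1/2, 1/2}"
  proof (rule crossing_params_eqI)
    show "\<forall>t \<in> {-1/2, 1/2}. t \<in> {-1..1} \<and> (\<exists>l \<in> set [0..<1]. (l = 0 \<longrightarrow> t \<noteq> 0) \<and> (arcs RI ! l) (- t) = (arcs RI ! 0) t)"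
      by (simp add: power3_eq_cube power2_eq_square)
  next
    fix l s t assume l: "l < (1::nat)" and st: "(l = 0 \<longrightarrow> s \<noteq> t)" and eq: "(arcs RI ! l) s = (arcs RI ! 0) t"
    have "l = 0" using l by simp
    then have "s\<^sup>2 = t\<^sup>2" and cube: "4 * s ^ 3 - s = 4 * t ^ 3 - t" and "s \<noteq> t" using eq st by simp_all
    \<comment> \<open>The second coordinate is even in the parameter and the first is odd, so a
      self-crossing joins \<open>t\<close> to \<open>-t\<close> and lies where the first coordinate
      vanishes.\<close>
    then have s: "s = - t" by (metis power2_eq_iff)
    then have "t \<noteq> 0" using \<open>s \<noteq> t\<close> by auto
    moreover have "t * (t\<^sup>2 - 1/4) = 0"
      using cube unfolding s by (simp add: power2_eq_square power3_eq_cube algebra_simps)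
    ultimately have "t\<^sup>2 = 1/4" by simp
    then show "t \<in> {-1/2, 1/2}" unfolding square_eq_quarter by blast
  qed
  then show ?thesis by (simp add: sorted_list_of_set_doubleton power3_eq_cube power2_eq_square)
qed

lemma crossings_RI': "crossing_params 1 ((!) (arcs' RI)) 0 = {}"
  by (rule crossing_params_eqI) auto

text \<open>Label 0 is the left corner of the bigon and 1 the right one; the second arc runs from
  right to left.\<close>

lemma crossings_RII:
  assumes "k < 2"
  shows "map (arcs_RII ! k) (sorted_list_of_set (crossing_params 2 ((!) arcs_RII) k)) =
     map ((!) [(-1/2, 0), (1/2, 0)]) ([[0, 1], [1, 0]] ! k)"
proof -
  have "crossing_params 2 ((!) arcs_RII) k = {-1/2, 1/2}"
  proof (rule crossing_params_eqI)
    show "\<forall>t \<in> {-1/2, 1/2}. t \<in> {-1..1} \<and> (\<exists>l \<in> set [0..<2]. (l = k \<longrightarrow> t \<noteq> 0) \<and> (arcs_RII ! l) (- t) = (arcs_RII ! k) t)"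
      using assms by (elim less_2_cases[THEN disjE]) (simp_all add: arcs_RII_def upt_rec power2_eq_square)
  next
    fix l s t assume "l < (2::nat)" and "(l = k \<longrightarrow> s \<noteq> t)" and "(arcs_RII ! l) s = (arcs_RII ! k) t"
    then have "t\<^sup>2 = 1/4"
      using assms by (auto simp: arcs_RII_def less_2_cases_iff)
    then show "t \<in> {-1/2, 1/2}" unfolding square_eq_quarter by blast
  qed
  then show ?thesis
    using assms by (auto simp: arcs_RII_def less_2_cases_iff power2_eq_square sorted_list_of_set_doubleton)
qed

lemma crossings_RII': "k < 2 \<Longrightarrow> crossing_params 2 ((!) arcs_RII') k = {}"
  by (rule crossing_params_eqI) (auto simp: arcs_RII'_def less_2_cases_iff)

text \<open>Labels 0 and 1 are the left and right crossings of the moved arc, and 2 is the origin.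
  Each pair of arcs shares one label, which gives the cyclic pattern of a coherent triangle.\<close>

lemma crossings_RIII:
  assumes "k < 3"
  shows "map (arcs_RIII ! k) (sorted_list_of_set (crossing_params 3 ((!) arcs_RIII) k)) =
     map ((!) [(-1/2, 1/4), (1/2, 1/4), (0, 0)]) ([[0, 1], [1, 2], [2, 0]] ! k)"
proof -
  define X :: "real set list" where "X = [{-1/2, 1/2}, {-1/2, 0}, {0, 1/2}]"
  have "crossing_params 3 ((!) arcs_RIII) k = X ! k"
  proof (rule crossing_params_eqI)
    show "\<forall>t \<in> X ! k. t \<in> {-1..1} \<and> (\<exists>l \<in> set [0..<3]. (l = k \<longrightarrow> t \<noteq> 0) \<and> (arcs_RIII ! l) (- t) = (arcs_RIII ! k) t)"
      using assms by (elim less_3_cases) (simp_all add: X_def arcs_RIII_def upt_rec power2_eq_square)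
  next
    fix l s t assume l: "l < (3::nat)" and ne: "(l = k \<longrightarrow> s \<noteq> t)" and eq: "(arcs_RIII ! l) s = (arcs_RIII ! k) t"
      and s: "s \<in> {-1..1}" and t: "t \<in> {-1..1}"
    have c: "2 * (1 - t\<^sup>2) = 3 * t \<longrightarrow> t = 1/2" "2 * (1 - t\<^sup>2) = - 3 * t \<longrightarrow> t = -1/2"
      using parabola_meets_line[of t] parabola_meets_line[of "- t"] t by auto
    show "t \<in> X ! k"
      using assms l ne eq
      apply (elim less_3_cases) apply (simp_all add: X_def arcs_RIII_def)
      subgoal by (elim conjE) (use c in simp)
      subgoal by (elim conjE) (use c in simp)
      subgoal by (elim conjE) (use c in simp)
      subgoal by (elim conjE) (use c in simp)
      done
  qed
  then show ?thesis
    using assms by (elim less_3_cases) (simp_all add: X_def arcs_RIII_def power2_eq_square sorted_list_of_set_doubleton)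
qed

text \<open>A label stands for a pair of arcs, not for a position. Below the origin, the moved arc
  meets the two lines in the opposite order, so label 0 is now on the right and 1 on the left; with
  this choice every list is the reverse of its counterpart.\<close>

lemma crossings_RIII':
  assumes "k < 3"
  shows "map (arcs_RIII' ! k) (sorted_list_of_set (crossing_params 3 ((!) arcs_RIII') k)) =
     map ((!) [(1/2, -1/4), (-1/2, -1/4), (0, 0)]) (rev ([[0, 1], [1, 2], [2, 0]] ! k))"
proof -
  define X :: "real set list" where "X = [{-1/2, 1/2}, {0, 1/2}, {-1/2, 0}]"
  have "crossing_params 3 ((!) arcs_RIII') k = X ! k"
  proof (rule crossing_params_eqI)
    show "\<forall>t \<in> X ! k. t \<in> {-1..1} \<and> (\<exists>l \<in> set [0..<3]. (l = k \<longrightarrow> t \<noteq> 0) \<and> (arcs_RIII' ! l) (- t) = (arcs_RIII' ! k) t)"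
      using assms by (elim less_3_cases) (simp_all add: X_def arcs_RIII'_def upt_rec power2_eq_square)
  next
    fix l s t assume l: "l < (3::nat)" and ne: "(l = k \<longrightarrow> s \<noteq> t)" and eq: "(arcs_RIII' ! l) s = (arcs_RIII' ! k) t"
      and s: "s \<in> {-1..1}" and t: "t \<in> {-1..1}"
    have c: "t * 2 = 1" if "2 * (1 - t\<^sup>2) = 3 * t"
      using parabola_meets_line[of t] t that by simp
    have c': "t = - (1/2)" if "2 * (1 - t\<^sup>2) = - 3 * t"
      using parabola_meets_line[of "- t"] t that by simp
    show "t \<in> X ! k"
      using assms l ne eq
      apply (elim less_3_cases) apply (simp_all add: X_def arcs_RIII'_def)
      subgoal premises p
      proof -
        have "2 * (1 - t\<^sup>2) = - 3 * t" using p by auto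
        then show ?thesis using c' by blast
      qed
      subgoal premises p
      proof -
        have "2 * (1 - t\<^sup>2) = 3 * t" using p by auto
        then show ?thesis using c by blast
      qed
      subgoal premises p
      proof -
        have "2 * (1 - t\<^sup>2) = 3 * t" using p by auto
        then show ?thesis using c by blast
      qed
      subgoal premises p
      proof -
        have "2 * (1 - t\<^sup>2) = - 3 * t" using p by auto
        then show ?thesis using c' by blast
      qed
      done
  qed
  then show ?thesis
    using assms by (elim less_3_cases) (simp_all add: X_def arcs_RIII'_def power2_eq_square sorted_list_of_set_doubleton)
qed

section \<open>Local moves\<close>

definition orient :: "real \<Rightarrow> 'b list \<Rightarrow> 'b list" where
  "orient s p = (if s = 1 then p else rev p)"

lemma set_orient [simp]: "set (orient s p) = set p"
  by (simp add: orient_def)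

lemma rev_orient: "rev (orient s p) = orient s (rev p)"
  by (simp add: orient_def)

context passage
begin

lemma inside_pattern:
  assumes "k < n" and "map (A k) (sorted_list_of_set (crossing_params n A k)) = map ((!) pts) p"
  shows "inside k = map (\<lambda>i. h (pts ! i)) (orient (e k) p)"
  unfolding inside_def inside_word[OF assms(1)] assms(2)
  by (simp add: orient_def rev_map o_def)

lemma crossing_letters:
  assumes "distinct pts" and "set pts \<subseteq> square"
  shows "inj_on (\<lambda>i. h (pts ! i)) {..<length pts}"
    and "(\<lambda>i. h (pts ! i)) ` {..<length pts} \<subseteq> h ` square"
proof -
  have sq: "pts ! i \<in> square" if "i < length pts" for i
    using assms(2) nth_mem[OF that] by blast
  show "inj_on (\<lambda>i. h (pts ! i)) {..<length pts}"
    using inj_on_eq_iff[OF inj_h sq sq] nth_eq_iff_index_eq[OF assms(1)]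
    by (intro inj_onI) simp
  show "(\<lambda>i. h (pts ! i)) ` {..<length pts} \<subseteq> h ` square"
    using sq by blast
qed

end

text \<open>Outer letters are the same points read at the same times on both sides, so the gaps are
  equal words and not merely isomorphic ones.\<close>

lemma gap_cong:
  assumes "passage M g h A n a b e" and "passage M' g' h' A' n a b e'"
    and "\<And>t. t \<in> {0..1} - (\<Union>k<n. {a k..b k}) \<Longrightarrow> g' t = g t"
  shows "passage.gap g' n a b J = passage.gap g n a b J"
proof -
  interpret g: passage M g h A n a b e by fact
  interpret g': passage M' g' h' A' n a b e' by fact
  have eq: "g' t = g t" if "t \<in> {0..<1} - g.inner" for t
    using assms(3)[of t] that by (auto simp: g.inner_def)
  have "double_times g' - g.inner = double_times g - g.inner"
    unfolding g.outer_double_times g'.outer_double_times using eq by (intro Collect_cong) metis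
  moreover have "double_times g - g.inner \<subseteq> {0..<1} - g.inner" by (auto simp: double_times_def)
  ultimately show ?thesis
    unfolding g.gap_def g'.gap_def using eq g.finite_double_times by (auto intro!: map_cong)
qed

context relator_functional
begin

lemma sub_eval_passage_RI:
  assumes L: "\<And>r. r \<in> relators1 RI \<Longrightarrow> L r = 0"
    and p: "passage M g h ((!) (arcs RI)) 1 a b e" and p': "passage M g' h' ((!) (arcs' RI)) 1 a b e"
    and eq: "\<And>t. t \<in> {0..1} - (\<Union>k<1. {a k..b k}) \<Longrightarrow> g' t = g t"
  shows "sub_eval (word_of g) = sub_eval (word_of g')"
proof -
  interpret g: passage M g h "(!) (arcs RI)" 1 a b e by fact
  interpret g': passage M g' h' "(!) (arcs' RI)" 1 a b e by fact
  define pts :: "(real \<times> real) list" where "pts = [(0, -1/4)]"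
  have pts: "distinct pts" "set pts \<subseteq> square" "length pts = 1" by (auto simp: pts_def cbox_Pair_eq)
  have "g'.inside 0 = []"
    using g'.inside_word[of 0] unfolding g'.inside_def crossings_RI' by simp
  then have w': "word_of g' = g.gap {..<a 0} @ g.gap {b 0<..}"
    using g'.word_of_1 gap_cong[OF p p' eq] by simp
  have "map (arcs RI ! 0) (sorted_list_of_set (crossing_params 1 ((!) (arcs RI)) 0)) = map ((!) pts) [0, 0]"
    unfolding crossings_RI by (simp add: pts_def)
  from g.inside_pattern[OF _ this]
  have i: "g.inside 0 = map (\<lambda>i. h (pts ! i)) [0, 0]" by (simp add: orient_def)
  \<comment> \<open>Padded by an empty second passage and an empty last gap. The kink reads
    \<open>[0, 0]\<close> in either direction, so its sign has no effect.\<close>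
  have w: "word_of g = g.gap {..<a 0} @ map (\<lambda>i. h (pts ! i)) [0, 0] @ g.gap {b 0<..} @ map (\<lambda>i. h (pts ! i)) [] @ []"
    unfolding g.word_of_1[OF refl] i by simp
  have "(\<lambda>i. h (pts ! i)) ` {..<length pts} \<inter> set (g.gap {..<a 0} @ g.gap {b 0<..} @ []) = {}"
    using g.crossing_letters(2)[OF pts(1,2)] g.set_gap by fastforce
  then have "sub_eval (word_of g) = sub_eval (g.gap {..<a 0} @ g.gap {b 0<..} @ [])"
    unfolding w using gauss_word_word_of[OF g'.g] w' g.crossing_letters(1)[OF pts(1,2)] pts(3)
    by (intro sub_eval_remove[OF removable_RI[OF L]]) auto
  then show ?thesis using w' by simp
qed

text \<open>Removability is required for both orders, since the base point decides which arc is met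
  first. The word of \<open>g'\<close> consists of the gaps alone, whence these form a Gauss
  word.\<close>

lemma sub_eval_passage_RII:
  assumes p: "passage M g h ((!) arcs_RII) 2 a b e" and p': "passage M g' h' ((!) arcs_RII') 2 a b e"
    and eq: "\<And>t. t \<in> {0..1} - (\<Union>k<2. {a k..b k}) \<Longrightarrow> g' t = g t"
    and rem: "\<And>k l. {k, l} = {0, 1} \<Longrightarrow>
       removable (orient (e k) ([[0, 1], [1, 0]] ! k)) (orient (e l) ([[0, 1], [1, 0]] ! l))"
  shows "sub_eval (word_of g) = sub_eval (word_of g')"
proof -
  interpret g: passage M g h "(!) arcs_RII" 2 a b e by fact
  interpret g': passage M g' h' "(!) arcs_RII'" 2 a b e by fact
  define pts :: "(real \<times> real) list" where "pts = [(-1/2, 0), (1/2, 0)]"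
  have pts: "distinct pts" "set pts \<subseteq> square" "length pts = 2" by (auto simp: pts_def cbox_Pair_eq)
  have i': "g'.inside k = []" if "k < 2" for k
    using g'.inside_word[OF that] by (simp add: g'.inside_def crossings_RII'[OF that])
  define N :: "nat \<Rightarrow> nat list" where "N k = orient (e k) ([[0, 1], [1, 0]] ! k)" for k
  have i: "g.inside k = map (\<lambda>i. h (pts ! i)) (N k)" if "k < 2" for k
    using g.inside_pattern[OF that crossings_RII[OF that]] by (simp add: pts_def N_def)
  have N: "set (N k) \<subseteq> {..<2}" if "k < 2" for k
    using that by (auto simp: N_def less_2_cases_iff)
  have *: ?thesis if kl: "{k, l} = {0, 1}" and "b k < a l" for k l
  proof -
    have k: "{..<2} = {k, l}" unfolding kl by auto
    then have lt: "k < 2" "l < 2" by blast+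
    have w': "word_of g' = g.gap {..<a k} @ g.gap {b k<..<a l} @ g.gap {b l<..}"
      using g'.word_of_2[OF refl k that(2)] i' lt gap_cong[OF p p' eq] by simp
    have "(\<lambda>i. h (pts ! i)) ` {..<length pts} \<inter> set (g.gap {..<a k} @ g.gap {b k<..<a l} @ g.gap {b l<..}) = {}"
      using g.crossing_letters(2)[OF pts(1,2)] g.set_gap by fastforce
    then show ?thesis
      unfolding w' g.word_of_2[OF refl k that(2)] i[OF lt(1)] i[OF lt(2)]
      using gauss_word_word_of[OF g'.g] w' g.crossing_letters(1)[OF pts(1,2)] pts(3) N[OF lt(1)] N[OF lt(2)]
        rem[OF kl]
      by (intro sub_eval_remove[where n = 2]) (auto simp: N_def)
  qed
  show ?thesis
    using g.intervals_ordered[of 0 1] *[of 0 1] *[of 1 0] by auto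
qed

lemma sub_eval_passage_RIII:
  assumes p: "passage M g h ((!) arcs_RIII) 3 a b e" and p': "passage M g' h' ((!) arcs_RIII') 3 a b e"
    and eq: "\<And>t. t \<in> {0..1} - (\<Union>k<3. {a k..b k}) \<Longrightarrow> g' t = g t"
    and im: "h' ` square = h ` square"
    and ex: "\<And>k l m. {k, l, m} = {0, 1, 2} \<Longrightarrow>
       exchanges (orient (e k) ([[0, 1], [1, 2], [2, 0]] ! k)) (orient (e l) ([[0, 1], [1, 2], [2, 0]] ! l))
         (orient (e m) ([[0, 1], [1, 2], [2, 0]] ! m))"
  shows "sub_eval (word_of g) = sub_eval (word_of g')"
proof -
  interpret g: passage M g h "(!) arcs_RIII" 3 a b e by fact
  interpret g': passage M g' h' "(!) arcs_RIII'" 3 a b e by fact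
  define pts :: "(real \<times> real) list" where "pts = [(-1/2, 1/4), (1/2, 1/4), (0, 0)]"
  define pts' :: "(real \<times> real) list" where "pts' = [(1/2, -1/4), (-1/2, -1/4), (0, 0)]"
  have pts: "distinct pts" "set pts \<subseteq> square" "length pts = 3" by (auto simp: pts_def cbox_Pair_eq)
  have pts': "distinct pts'" "set pts' \<subseteq> square" "length pts' = 3" by (auto simp: pts'_def cbox_Pair_eq)
  define N :: "nat \<Rightarrow> nat list" where "N k = orient (e k) ([[0, 1], [1, 2], [2, 0]] ! k)" for k
  have i: "g.inside k = map (\<lambda>i. h (pts ! i)) (N k)" if "k < 3" for k
    using g.inside_pattern[OF that crossings_RIII[OF that]] by (simp add: pts_def N_def)
  have i': "g'.inside k = map (\<lambda>i. h' (pts' ! i)) (rev (N k))" if "k < 3" for k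
    using g'.inside_pattern[OF that crossings_RIII'[OF that]] by (simp add: pts'_def N_def rev_orient)
  have N: "set (N k) \<subseteq> {..<3}" if "k < 3" for k
    using that by (elim less_3_cases) (auto simp: N_def)
  have *: ?thesis if klm: "{k, l, m} = {0, 1, 2}" and le: "b k < a l" "b l < a m" for k l m
  proof -
    have k: "{..<3} = {k, l, m}" unfolding klm by auto
    then have lt: "k < 3" "l < 3" "m < 3" by blast+
    let ?S = "g.gap {..<a k}" and ?T = "g.gap {b k<..<a l}" and ?U = "g.gap {b l<..<a m}" and ?V = "g.gap {b m<..}"
    have w: "word_of g = ?S @ g.inside k @ ?T @ g.inside l @ ?U @ g.inside m @ ?V"
      by (rule g.word_of_3[OF refl k le])
    have out: "set (?S @ ?T @ ?U @ ?V) \<inter> h ` square = {}" using g.set_gap by auto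
    \<comment> \<open>Both sides of RIII have letters in the disc; deleting them shows that the gaps
      form a Gauss word.\<close>
    have "filter (\<lambda>y. y \<notin> h ` square) (word_of g) = ?S @ ?T @ ?U @ ?V"
    proof -
      have "filter (\<lambda>y. y \<notin> h ` square) (g.gap J) = g.gap J" for J
        using g.set_gap by (intro filter_True) blast
      moreover have "filter (\<lambda>y. y \<notin> h ` square) (g.inside j) = []" if "j < 3" for j
        using g.set_inside[OF that] by (intro filter_False) blast
      ultimately show ?thesis using lt by (simp add: w)
    qed
    then have gw: "gauss_word (?S @ ?T @ ?U @ ?V)"
      using gauss_word_filter[OF gauss_word_word_of[OF g.g]] by metis
    have w': "word_of g' = ?S @ g'.inside k @ ?T @ g'.inside l @ ?U @ g'.inside m @ ?V"
      using g'.word_of_3[OF refl k le] gap_cong[OF p p' eq] by simp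
    have "(\<lambda>i. h (pts ! i)) ` {..<3} \<inter> set (?S @ ?T @ ?U @ ?V) = {}"
      using g.crossing_letters(2)[OF pts(1,2)] out pts(3) by auto
    moreover have "(\<lambda>i. h' (pts' ! i)) ` {..<3} \<inter> set (?S @ ?T @ ?U @ ?V) = {}"
      using g'.crossing_letters(2)[OF pts'(1,2)] out pts'(3) im by auto
    ultimately show ?thesis
      unfolding w w' i[OF lt(1)] i[OF lt(2)] i[OF lt(3)] i'[OF lt(1)] i'[OF lt(2)] i'[OF lt(3)]
      using gw g.crossing_letters(1)[OF pts(1,2)] g'.crossing_letters(1)[OF pts'(1,2)] pts(3) pts'(3)
        N[OF lt(1)] N[OF lt(2)] N[OF lt(3)] ex[OF klm]
      by (intro sub_eval_exchange[where n = 3]) (simp_all add: N_def)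
  qed
  have "b 0 < a 1 \<or> b 1 < a 0" "b 0 < a 2 \<or> b 2 < a 0" "b 1 < a 2 \<or> b 2 < a 1"
    using g.intervals_ordered[of 0 1] g.intervals_ordered[of 0 2] g.intervals_ordered[of 1 2] by auto
  moreover have "a 0 < b 0" "a 1 < b 1" "a 2 < b 2" using g.bounds by simp_all
  ultimately consider "b 0 < a 1" "b 1 < a 2" | "b 0 < a 2" "b 2 < a 1" | "b 1 < a 0" "b 0 < a 2"
    | "b 1 < a 2" "b 2 < a 0" | "b 2 < a 0" "b 0 < a 1" | "b 2 < a 1" "b 1 < a 0"
    by linarith
  then show ?thesis
    by cases (rule *; (assumption | blast))+
qed

text \<open>Equal signs leave the two lists opposite to each other, as in strong RII; different
  signs make them equal, as in weak RII.\<close>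

lemma removable_orient:
  assumes "m = strong_RII \<or> m = weak_RII" and "\<And>r. r \<in> relators1 m \<Longrightarrow> L r = 0"
    and "admissible_signs m e" and "e 0 \<in> {1, -1}" "e 1 \<in> {1, -1}" and kl: "{k, l} = {0, 1::nat}"
  shows "removable (orient (e k) ([[0, 1], [1, 0]] ! k)) (orient (e l) ([[0, 1], [1, 0]] ! l))"
proof -
  have "k = 0 \<and> l = 1 \<or> k = 1 \<and> l = 0" using kl unfolding doubleton_eq_iff by simp
  then show ?thesis
    using assms(1-5) removable_strong[of 0 1] removable_strong[of 1 0] removable_weak[of 0 1] removable_weak[of 1 0]
    by (auto simp: orient_def)
qed

lemma permutation_of_3:
  assumes "{k, l, m} = {0, 1, 2::nat}"
  shows "(k, l, m) \<in> {(0, 1, 2), (0, 2, 1), (1, 0, 2), (1, 2, 0), (2, 0, 1), (2, 1, 0)}"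
proof -
  have "k \<in> {0, 1, 2}" "l \<in> {0, 1, 2}" "m \<in> {0, 1, 2}" unfolding assms[symmetric] by simp_all
  then have "k = 0 \<or> k = 1 \<or> k = 2" "l = 0 \<or> l = 1 \<or> l = 2" "m = 0 \<or> m = 1 \<or> m = 2" by blast+
  moreover have "0 \<in> {k, l, m}" "1 \<in> {k, l, m}" "2 \<in> {k, l, m}" unfolding assms by simp_all
  ultimately show ?thesis by (elim disjE) simp_all
qed

text \<open>The pattern \<open>[i, j] [k, i] [j, k]\<close> is mapped to itself by cyclic rotation
  up to renaming. Hence it and its reversal suffice; the common sign and the cyclic order of the
  arcs decide between them.\<close>

lemma exchanges_orient_strong:
  assumes L: "\<And>r. r \<in> relators1 strong_RIII \<Longrightarrow> L r = 0"
    and adm: "admissible_signs strong_RIII e" and e: "e 0 \<in> {1, -1}"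
    and klm: "{k, l, m} = {0, 1, 2::nat}"
  shows "exchanges (orient (e k) ([[0, 1], [1, 2], [2, 0]] ! k)) (orient (e l) ([[0, 1], [1, 2], [2, 0]] ! l))
         (orient (e m) ([[0, 1], [1, 2], [2, 0]] ! m))"
proof -
  note X = exchanges_strong[OF L]
  note X' = exchanges_rev[OF X, simplified]
  show ?thesis
    using permutation_of_3[OF klm] adm e by (auto simp: orient_def intro!: X X')
qed

text \<open>The pattern \<open>[i, j] [i, k] [j, k]\<close> has no cyclic symmetry, so its rotations
  enter as well. With reversals and renamings they cover all six nonconstant sign patterns in all
  six orders of the arcs.\<close>

lemma exchanges_orient_weak:
  assumes L: "\<And>r. r \<in> relators1 weak_RIII \<Longrightarrow> L r = 0"
    and adm: "admissible_signs weak_RIII e" and e: "e 0 \<in> {1, -1}" "e 1 \<in> {1, -1}" "e 2 \<in> {1, -1}"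
    and klm: "{k, l, m} = {0, 1, 2::nat}"
  shows "exchanges (orient (e k) ([[0, 1], [1, 2], [2, 0]] ! k)) (orient (e l) ([[0, 1], [1, 2], [2, 0]] ! l))
         (orient (e m) ([[0, 1], [1, 2], [2, 0]] ! m))"
proof -
  note X = exchanges_weak[OF L]
  note Y = exchanges_rotate[OF X]
  note Z = exchanges_rotate[OF Y]
  note X' = exchanges_rev[OF X, simplified] exchanges_rev[OF Y, simplified] exchanges_rev[OF Z, simplified]
  show ?thesis
    using permutation_of_3[OF klm] adm e by (auto simp: orient_def intro!: X Y Z X')
qed

lemma sub_eval_local_move:
  assumes L: "\<And>r. r \<in> relators1 m \<Longrightarrow> L r = 0" and "local_move M m P P'"
  shows "\<exists>g g'. generic_immersion M g \<and> range g = P \<and> generic_immersion M g' \<and> range g' = P' \<and>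
    sub_eval (word_of g) = sub_eval (word_of g')"
proof -
  define n where "n = length (arcs m)"
  obtain g g' h h' a b e where
    g: "generic_immersion M g" "range g = P" "generic_immersion M g'" "range g' = P'" and
    h: "inj_on h square" "inj_on h' square" "h' ` square = h ` square" and
    I: "\<forall>k<n. 0 < a k \<and> a k < b k \<and> b k < 1 \<and> e k \<in> {1, -1}"
      "disjoint_family_on (\<lambda>k. {a k..b k}) {..<n}" and
    adm: "admissible_signs m e" and
    tr: "\<forall>k<n. traverses g (a k) (b k) (h \<circ> arcs m ! k) (e k) \<and>
               traverses g' (a k) (b k) (h' \<circ> arcs' m ! k) (e k)" and
    out: "\<forall>t \<in> {0..1} - (\<Union>k<n. {a k..b k}). g' t = g t \<and> g t \<notin> h ` square"
    using assms(2) unfolding local_move_def Let_def n_def[symmetric]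
    by (elim exE conjE) (rule that; assumption)
  have sq: "(arcs m ! k) t \<in> square" "(arcs' m ! k) t \<in> square" if "k < n" "t \<in> {-1..1}" for k t
    using all_arcs_in_square[OF that(2), of m] that(1) nth_mem[of k "arcs m"] nth_mem[of k "arcs' m"]
    unfolding n_def by auto
  have p: "passage M g h ((!) (arcs m)) n a b e"
    using g h I tr out sq by unfold_locales auto
  have p': "passage M g' h' ((!) (arcs' m)) n a b e"
    using g h I tr out sq by unfold_locales auto
  have eq: "g' t = g t" if "t \<in> {0..1} - (\<Union>k<n. {a k..b k})" for t
    using out that by blast
  have e: "e k \<in> {1, -1}" if "k < n" for k using I(1) that by blast
  have "sub_eval (word_of g) = sub_eval (word_of g')"
  proof (cases m)
    case RI
    then have n: "n = 1" by (simp add: n_def)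
    show ?thesis
      using sub_eval_passage_RI[of M g h a b e g' h'] L p p' eq unfolding RI n by blast
  next
    case m: strong_RII
    then have n: "n = 2" by (simp add: n_def arcs_RII_def)
    have "removable (orient (e k) ([[0, 1], [1, 0]] ! k)) (orient (e l) ([[0, 1], [1, 0]] ! l))"
      if "{k, l} = {0, 1}" for k l
      using removable_orient[OF _ L adm e e that] m n by simp
    then show ?thesis
      using sub_eval_passage_RII[of M g h a b e g' h'] p p' eq unfolding m n arcs.simps arcs'.simps by blast
  next
    case m: weak_RII
    then have n: "n = 2" by (simp add: n_def arcs_RII_def)
    have "removable (orient (e k) ([[0, 1], [1, 0]] ! k)) (orient (e l) ([[0, 1], [1, 0]] ! l))"
      if "{k, l} = {0, 1}" for k l
      using removable_orient[OF _ L adm e e that] m n by simp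
    then show ?thesis
      using sub_eval_passage_RII[of M g h a b e g' h'] p p' eq unfolding m n arcs.simps arcs'.simps by blast
  next
    case m: strong_RIII
    then have n: "n = 3" by (simp add: n_def arcs_RIII_def)
    note exchanges_orient_strong[OF L[unfolded m] adm[unfolded m] e]
    then show ?thesis
      using sub_eval_passage_RIII[of M g h a b e g' h'] p p' eq h(3) unfolding m n arcs.simps arcs'.simps by simp
  next
    case m: weak_RIII
    then have n: "n = 3" by (simp add: n_def arcs_RIII_def)
    note exchanges_orient_weak[OF L[unfolded m] adm[unfolded m] e e e]
    then show ?thesis
      using sub_eval_passage_RIII[of M g h a b e g' h'] p p' eq h(3) unfolding m n arcs.simps arcs'.simps by simp
  qed
  with g show ?thesis by blast
qed

end

section \<open>Invariance\<close>

text \<open>The number of chords does not decrease along the enumeration, so the indices of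
  \<open>G_upto d\<close> form an initial segment, whose length is the cardinality
  \<open>n_upto d\<close>.\<close>

lemma chord_enumeration_G_upto:
  assumes x: "chord_enumeration x" and fin: "finite (G_upto d)" and "1 \<le> i"
  shows "x i \<in> G_upto d \<longleftrightarrow> i \<le> n_upto d"
proof -
  have bij: "bij_betw x {1..} UNIV"
    and mono: "\<And>i j. 1 \<le> i \<Longrightarrow> i \<le> j \<Longrightarrow> num_chords (x i) \<le> num_chords (x j)"
    using x unfolding chord_enumeration_def by blast+
  have inj: "inj_on x {1..}" and im: "x ` {1..} = UNIV" using bij by (auto simp: bij_betw_def)
  define I where "I = {i \<in> {1..}. x i \<in> G_upto d}"
  have "x ` I = x ` {1..} \<inter> G_upto d" unfolding I_def by auto
  then have "x ` I = G_upto d" unfolding im by simp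
  moreover have injI: "inj_on x I" using inj by (rule inj_on_subset) (auto simp: I_def)
  ultimately have card: "card I = n_upto d" and finI: "finite I"
    using card_image[OF injI] fin finite_image_iff[OF injI] by (auto simp: n_upto_def)
  have down: "{1..i} \<subseteq> I" if "i \<in> I" for i
  proof
    fix j assume "j \<in> {1..i}"
    then have "num_chords (x j) \<le> num_chords (x i)" using mono by simp
    then show "j \<in> I" using that \<open>j \<in> {1..i}\<close> by (simp add: I_def G_upto_def)
  qed
  show ?thesis
  proof
    assume "x i \<in> G_upto d"
    then have "{1..i} \<subseteq> I" using down assms(3) by (simp add: I_def)
    then show "i \<le> n_upto d" using card_mono[OF finI, of "{1..i}"] card by simp
  next
    assume le: "i \<le> n_upto d"
    show "x i \<in> G_upto d"
    proof (rule ccontr)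
      assume "x i \<notin> G_upto d"
      then have "i \<notin> I" by (simp add: I_def)
      have "I \<subseteq> {1..<i}"
      proof
        fix j assume j: "j \<in> I"
        then have "\<not> i \<le> j" using down[OF j] assms(3) \<open>i \<notin> I\<close> by auto
        then show "j \<in> {1..<i}" using j by (simp add: I_def)
      qed
      then have "card I \<le> i - 1" using card_mono[of "{1..<i}" I] by simp
      then show False using card le assms(3) by simp
    qed
  qed
qed

lemma chord_enumeration_G_between:
  assumes "chord_enumeration x" and i: "i \<in> {n_upto (b - 1) + 1..n_upto d}" and "b \<le> d"
  shows "x i \<in> G_between b d"
proof -
  have i1: "1 \<le> i" and i2: "i \<le> n_upto d" "\<not> i \<le> n_upto (b - 1)" using i by simp_all
  \<comment> \<open>An infinite set has \<open>card\<close> 0, which would leave no index in the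
    given range.\<close>
  have fin: "finite (G_upto d)"
  proof (rule ccontr)
    assume "infinite (G_upto d)"
    then have "n_upto d = 0" by (simp add: n_upto_def)
    then show False using i1 i2(1) by simp
  qed
  have "G_upto (b - 1) \<subseteq> G_upto d" using assms(3) by (auto simp: G_upto_def)
  then have fin': "finite (G_upto (b - 1))" using fin by (rule finite_subset)
  show ?thesis
    unfolding G_between_def
    using chord_enumeration_G_upto[OF assms(1) fin i1] chord_enumeration_G_upto[OF assms(1) fin' i1] i2
    by simp
qed

lemma dual_proj:
  assumes "y \<in> G_between b d"
  shows "dual y (proj b d r) = dual y r"
proof -
  let ?p = "\<lambda>x. if x \<in> G_between b d then frag_of x else 0"
  have "dual y (frag_extend ?p r) = dual y r"
    using subset_UNIV
  proof (induction r rule: frag_induction)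
    case (one x)
    then show ?case using assms by (auto simp: dual_def)
  next
    case (diff r s)
    then show ?case by (simp add: dual_def frag_extend_diff lookup_minus)
  qed (simp_all add: dual_def)
  then show ?thesis by (simp add: proj_def)
qed

text \<open>Exchanging the sum over diagrams with the sum over sub-words turns the function into the
  value of a single functional on the formal sum of all sub-diagrams, where relators can be
  applied.\<close>

lemma diagram_function_eq:
  fixes g :: "real \<Rightarrow> 'a::euclidean_space"
  assumes "generic_immersion M g"
  shows "diagram_function x \<alpha> b d M (range g) =
    sub_sum (\<lambda>y. \<Sum>i = n_upto (b - 1) + 1..n_upto d. \<alpha> i * dual (x i) (frag_of y)) (word_of g)"
proof -
  have "\<alpha> i * int (sub_count (x i) (CD M (range g))) =
      sub_sum (\<lambda>y. \<alpha> i * dual (x i) (frag_of y)) (word_of g)" for i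
    unfolding CD_range[OF assms] sub_count_diagram[OF gauss_word_word_of[OF assms]]
    by (simp add: sub_sum_def sum_distrib_left dual_def eq_commute[of "x i"])
  then show ?thesis
    unfolding diagram_function_def by (simp add: sub_sum_def) (rule sum.swap)
qed

lemma diagram_function_isotopy_invariant: "isotopy_invariant M (diagram_function x \<alpha> b d M)"
  unfolding isotopy_invariant_def diagram_function_def using CD_ambient_isotopic by metis

lemma diagram_function_move_invariant:
  assumes x: "chord_enumeration x" and "b \<le> d"
    and R: "\<And>r. r \<in> relators_between (indicator {m}) b d \<Longrightarrow>
           (\<Sum>i = n_upto (b - 1) + 1..n_upto d. \<alpha> i * dual (x i) r) = 0"
  shows "move_invariant M m (diagram_function x \<alpha> b d M)"
proof -
  let ?F = "diagram_function x \<alpha> b d M"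
  define L where "L r = (\<Sum>i = n_upto (b - 1) + 1..n_upto d. \<alpha> i * dual (x i) r)" for r
  interpret relator_functional L
    by unfold_locales (simp add: L_def dual_def lookup_add algebra_simps sum.distrib)
  have L0: "L r = 0" if "r \<in> relators1 m" for r
  proof -
    have "proj b d r \<in> relators_between (indicator {m}) b d"
      using that by (auto simp: relators_between_def relators_def indicator_def)
    moreover have "L (proj b d r) = L r"
      unfolding L_def using dual_proj chord_enumeration_G_between[OF x _ assms(2)]
      by (intro sum.cong) auto
    ultimately show ?thesis using R by (simp add: L_def)
  qed
  have "?F P = ?F P'" if mv: "local_move M m P P'" for P P'
  proof -
    obtain g g' where g: "generic_immersion M g" "range g = P" "generic_immersion M g'" "range g' = P'"
      and eq: "sub_eval (word_of g) = sub_eval (word_of g')"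
      using sub_eval_local_move[OF L0 mv] by blast
    show ?thesis
      using eq diagram_function_eq[OF g(1), of x \<alpha> b d] diagram_function_eq[OF g(3), of x \<alpha> b d]
      unfolding L_def g(2,4) by simp
  qed
  then show ?thesis unfolding move_invariant_def move_related_def by metis
qed

theorem theorem1:
  fixes x :: "nat \<Rightarrow> chord_diagram" and \<alpha> :: "nat \<Rightarrow> int"
    and \<epsilon> :: "move \<Rightarrow> nat" and b d :: nat
  assumes "chord_enumeration x"
    and "2 \<le> b" and "b \<le> d"
    and "\<And>m. \<epsilon> m \<in> {0, 1}"
    and "\<And>m r. \<epsilon> m = 1 \<Longrightarrow> r \<in> relators_between (indicator {m}) b d \<Longrightarrow>
           (\<Sum>i = n_upto (b - 1) + 1..n_upto d. \<alpha> i * dual (x i) r) = 0"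
  shows "(isotopy_invariant unit_sphere (diagram_function x \<alpha> b d unit_sphere) \<and>
          (\<forall>m. \<epsilon> m = 1 \<longrightarrow> move_invariant unit_sphere m (diagram_function x \<alpha> b d unit_sphere))) \<and>
         (isotopy_invariant plane (diagram_function x \<alpha> b d plane) \<and>
          (\<forall>m. \<epsilon> m = 1 \<longrightarrow> move_invariant plane m (diagram_function x \<alpha> b d plane)))"
  by (intro conjI allI impI diagram_function_isotopy_invariant diagram_function_move_invariant[OF assms(1,3)])
    (rule assms(5); assumption)+

end
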